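(* Let $k$ be a field and let $H$ be a (not necessarily commutative) Hopf algebra over $k$ with bijective antipode which is left noetherian (in particular: finite dimensional), semisimple and cosemisimple. Then each $M\in {}_{H}\mathcal{L}^H$ is a direct sum in ${}_{H}\mathcal{L}^H$ of a family of simple subobjects of $M$ that are finitely generated as $H$-modules. Hence $M\in {}_{H}\mathcal{L}^H$ is semisimple, and ${}_{H}\mathcal{L}^H$ is a semisimple category.
   Context: Write $\rho(m)=m_0\otimes m_1\in M\otimes H$ for a right $H$-coaction (summation understood). A (left-right) Long dimodule is a $k$-vector space $M$ that is a left $H$-module and a right $H$-comodule such that $\rho(hm)=hm_0\otimes m_1$ for all $h\in H$, $m\in M$. ${}_{H}\mathcal{L}^H$ is the category of Long dimodules with $H$-linear $H$-colinear maps. "Semisimple" for $H$ means semisimple as an algebra, "cosemisimple" means cosemisimple as a coalgebra. An object of ${}_{H}\mathcal{L}^H$ is simple if it is nonzero and has no subobjects in ${}_{H}\mathcal{L}^H$ other than $0$ and itself; an object is semisimple if it is a direct sum of simple objects; the category is semisimple if every object is semisimple. *)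

theory Defs
  imports Complex_Main "HOL-Library.Poly_Mapping"
begin

section \<open>Formal linear combinations and tensor products\<close>

text \<open>The free \<open>k\<close>-vector space on a type \<open>'x\<close> is \<open>'x \<Rightarrow>\<^sub>0 'k\<close>.\<close>

definition fscale :: "'k::field \<Rightarrow> ('x \<Rightarrow>\<^sub>0 'k) \<Rightarrow> ('x \<Rightarrow>\<^sub>0 'k)" where
  "fscale c p = Poly_Mapping.map ((*) c) p"

lemma vector_space_fscale: "vector_space (fscale :: 'k::field \<Rightarrow> ('x \<Rightarrow>\<^sub>0 'k) \<Rightarrow> _)"
proof
  have l: "Poly_Mapping.lookup (fscale c p) x = c * Poly_Mapping.lookup p x" for c :: 'k and p :: "'x \<Rightarrow>\<^sub>0 'k" and x
    by (simp add: fscale_def Poly_Mapping.map.rep_eq when_def)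
  fix a b :: 'k and x y :: "'x \<Rightarrow>\<^sub>0 'k"
  show "fscale a (x + y) = fscale a x + fscale a y"
    by (rule poly_mapping_eqI) (simp add: l lookup_add distrib_left)
  show "fscale (a + b) x = fscale a x + fscale b x"
    by (rule poly_mapping_eqI) (simp add: l lookup_add distrib_right)
  show "fscale a (fscale b x) = fscale (a * b) x"
    by (rule poly_mapping_eqI) (simp add: l mult.assoc)
  show "fscale 1 x = x"
    by (rule poly_mapping_eqI) (simp add: l)
qed

text \<open>\<open>lin_extend s f\<close> is the linear extension of \<open>f\<close> to formal linear combinations,
  \<open>\<Sum> c\<^sub>i x\<^sub>i \<mapsto> \<Sum> s c\<^sub>i (f x\<^sub>i)\<close>.\<close>

definition lin_extend :: "('k::field \<Rightarrow> 'v::ab_group_add \<Rightarrow> 'v) \<Rightarrow> ('x \<Rightarrow> 'v) \<Rightarrow> ('x \<Rightarrow>\<^sub>0 'k) \<Rightarrow> 'v" where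
  "lin_extend s f p = (\<Sum>x\<in>Poly_Mapping.keys p. s (Poly_Mapping.lookup p x) (f x))"

text \<open>The relations in the free vector space which make the map \<open>v \<mapsto> e v\<close> linear.\<close>

definition linear_relations ::
  "('k::field \<Rightarrow> 'v::ab_group_add \<Rightarrow> 'v) \<Rightarrow> ('v \<Rightarrow> 'x) \<Rightarrow> ('x \<Rightarrow>\<^sub>0 'k) set" where
  "linear_relations s e =
     {Poly_Mapping.single (e (v + w)) 1 - Poly_Mapping.single (e v) 1 - Poly_Mapping.single (e w) 1 |v w. True}
   \<union> {Poly_Mapping.single (e (s c v)) 1 - Poly_Mapping.single (e v) c |c v. True}"

definition relations2 ::
  "('k::field \<Rightarrow> 'v::ab_group_add \<Rightarrow> 'v) \<Rightarrow> ('k \<Rightarrow> 'w::ab_group_add \<Rightarrow> 'w) \<Rightarrow> ('v \<times> 'w \<Rightarrow>\<^sub>0 'k) set" where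
  "relations2 sV sW = module.span fscale
     ((\<Union>w. linear_relations sV (\<lambda>v. (v, w))) \<union> (\<Union>v. linear_relations sW (\<lambda>w. (v, w))))"

definition relations3 ::
  "('k::field \<Rightarrow> 'u::ab_group_add \<Rightarrow> 'u) \<Rightarrow> ('k \<Rightarrow> 'v::ab_group_add \<Rightarrow> 'v) \<Rightarrow>
   ('k \<Rightarrow> 'w::ab_group_add \<Rightarrow> 'w) \<Rightarrow> ('u \<times> 'v \<times> 'w \<Rightarrow>\<^sub>0 'k) set" where
  "relations3 sU sV sW = module.span fscale
     ((\<Union>v w. linear_relations sU (\<lambda>u. (u, v, w))) \<union>
      (\<Union>u w. linear_relations sV (\<lambda>v. (u, v, w))) \<union>
      (\<Union>u v. linear_relations sW (\<lambda>w. (u, v, w))))"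

text \<open>The elements of \<open>V \<otimes> W\<close> and \<open>U \<otimes> V \<otimes> W\<close> are cosets in the free vector space;
  \<open>tensor2 sV sW\<close> and \<open>tensor3 sU sV sW\<close> are the quotient maps.\<close>

definition tensor2 where "tensor2 sV sW x = {y. y - x \<in> relations2 sV sW}"

definition tensor3 where "tensor3 sU sV sW x = {y. y - x \<in> relations3 sU sV sW}"

text \<open>For subspaces \<open>A\<close>, \<open>B\<close> of \<open>V\<close>, \<open>W\<close>, the subspace \<open>A \<otimes> B\<close> of \<open>V \<otimes> W\<close>
  (over a field the natural map from \<open>A \<otimes> B\<close> to \<open>V \<otimes> W\<close> is injective).\<close>

definition tensor_of ::
  "('k::field \<Rightarrow> 'v::ab_group_add \<Rightarrow> 'v) \<Rightarrow> ('k \<Rightarrow> 'w::ab_group_add \<Rightarrow> 'w) \<Rightarrow>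
   'v set \<Rightarrow> 'w set \<Rightarrow> ('v \<times> 'w \<Rightarrow>\<^sub>0 'k) set set" where
  "tensor_of sV sW A B = tensor2 sV sW ` {x. Poly_Mapping.keys x \<subseteq> A \<times> B}"

text \<open>Sweedler notation: a formal sum \<open>\<Sum> c\<^sub>i (a\<^sub>i, b\<^sub>i)\<close> with \<open>(a\<^sub>i, b\<^sub>i) \<in> A\<close>
  representing the tensor \<open>t\<close>. Below it is only used inside expressions whose value does not
  depend on the chosen representative.\<close>

definition sweedler :: "'x set \<Rightarrow> ('x \<Rightarrow>\<^sub>0 'k::field) set \<Rightarrow> ('x \<Rightarrow>\<^sub>0 'k)" where
  "sweedler A t = (SOME x. x \<in> t \<and> Poly_Mapping.keys x \<subseteq> A)"


section \<open>Internal direct sums\<close>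

text \<open>The canonical map from the external direct sum of the members of \<open>F\<close> to \<open>V\<close>
  is bijective. Indexing a family by its set of members loses nothing for nonzero summands,
  since the summands of an internal direct sum are then distinct.\<close>

definition direct_sum_carrier :: "'a::ab_group_add set set \<Rightarrow> ('a set \<Rightarrow> 'a) set" where
  "direct_sum_carrier F =
     {f. (\<forall>N\<in>F. f N \<in> N) \<and> (\<forall>N. N \<notin> F \<longrightarrow> f N = 0) \<and> finite {N. f N \<noteq> 0}}"

definition internal_direct_sum :: "'a::ab_group_add set set \<Rightarrow> 'a set \<Rightarrow> bool" where
  "internal_direct_sum F V \<longleftrightarrow>
     bij_betw (\<lambda>f. \<Sum>N | f N \<noteq> 0. f N) (direct_sum_carrier F) V"


section \<open>Semisimple and noetherian algebras\<close>

definition left_ideal :: "'h::ring_1 set \<Rightarrow> bool" where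
  "left_ideal I \<longleftrightarrow> 0 \<in> I \<and> (\<forall>x\<in>I. \<forall>y\<in>I. x + y \<in> I) \<and> (\<forall>h. \<forall>x\<in>I. h * x \<in> I)"

definition simple_left_ideal :: "'h::ring_1 set \<Rightarrow> bool" where
  "simple_left_ideal I \<longleftrightarrow> left_ideal I \<and> I \<noteq> {0} \<and>
     (\<forall>J. left_ideal J \<and> J \<subseteq> I \<longrightarrow> J = {0} \<or> J = I)"

definition left_noetherian :: "'h::ring_1 itself \<Rightarrow> bool" where
  "left_noetherian _ \<longleftrightarrow>
     (\<forall>I :: nat \<Rightarrow> 'h set. (\<forall>n. left_ideal (I n)) \<and> incseq I \<longrightarrow> (\<exists>n. \<forall>m\<ge>n. I m = I n))"

definition semisimple_algebra :: "'h::ring_1 itself \<Rightarrow> bool" where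
  "semisimple_algebra _ \<longleftrightarrow>
     (\<exists>F :: 'h set set. (\<forall>I\<in>F. simple_left_ideal I) \<and> internal_direct_sum F UNIV)"


section \<open>Hopf algebras\<close>

text \<open>The ring structure of \<open>H\<close> is that of the type \<open>'h\<close>; the record contains the remaining
  structure maps. The comultiplication takes values in \<open>H \<otimes> H\<close>.\<close>

record (overloaded) ('k::field, 'h) hopf =
  hscale :: "'k \<Rightarrow> 'h \<Rightarrow> 'h"
  comult :: "'h \<Rightarrow> ('h \<times> 'h \<Rightarrow>\<^sub>0 'k) set"
  counit :: "'h \<Rightarrow> 'k"
  antipode :: "'h \<Rightarrow> 'h"

definition k_algebra :: "('k::field, 'h::ring_1) hopf \<Rightarrow> bool" where
  "k_algebra H \<longleftrightarrow> vector_space (hscale H) \<and>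
     (\<forall>c x y. hscale H c (x * y) = hscale H c x * y \<and> hscale H c (x * y) = x * hscale H c y)"

abbreviation sweedlerH :: "('k::field, 'h::ring_1) hopf \<Rightarrow> 'h \<Rightarrow> ('h \<times> 'h \<Rightarrow>\<^sub>0 'k)" where
  "sweedlerH H h \<equiv> sweedler UNIV (comult H h)"

definition coalgebra :: "('k::field, 'h::ring_1) hopf \<Rightarrow> bool" where
  "coalgebra H \<longleftrightarrow> vector_space (hscale H) \<and>
     (\<forall>h. comult H h \<in> tensor_of (hscale H) (hscale H) UNIV UNIV) \<and>
     (\<forall>g h. comult H (g + h) = tensor2 (hscale H) (hscale H) (sweedlerH H g + sweedlerH H h)) \<and>
     (\<forall>c h. comult H (hscale H c h) = tensor2 (hscale H) (hscale H) (fscale c (sweedlerH H h))) \<and>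
     (\<forall>g h. counit H (g + h) = counit H g + counit H h) \<and>
     (\<forall>c h. counit H (hscale H c h) = c * counit H h) \<and>
     (\<forall>h. tensor3 (hscale H) (hscale H) (hscale H)
            (lin_extend fscale (\<lambda>(a, b). lin_extend fscale (\<lambda>(a1, a2). Poly_Mapping.single (a1, a2, b) 1)
               (sweedlerH H a)) (sweedlerH H h)) =
          tensor3 (hscale H) (hscale H) (hscale H)
            (lin_extend fscale (\<lambda>(a, b). lin_extend fscale (\<lambda>(b1, b2). Poly_Mapping.single (a, b1, b2) 1)
               (sweedlerH H b)) (sweedlerH H h))) \<and>
     (\<forall>h. lin_extend (hscale H) (\<lambda>(a, b). hscale H (counit H a) b) (sweedlerH H h) = h) \<and>
     (\<forall>h. lin_extend (hscale H) (\<lambda>(a, b). hscale H (counit H b) a) (sweedlerH H h) = h)"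

definition bialgebra :: "('k::field, 'h::ring_1) hopf \<Rightarrow> bool" where
  "bialgebra H \<longleftrightarrow> k_algebra H \<and> coalgebra H \<and>
     (\<forall>g h. comult H (g * h) = tensor2 (hscale H) (hscale H)
        (lin_extend fscale (\<lambda>(a, b). lin_extend fscale (\<lambda>(c, d). Poly_Mapping.single (a * c, b * d) 1)
           (sweedlerH H h)) (sweedlerH H g))) \<and>
     comult H 1 = tensor2 (hscale H) (hscale H) (Poly_Mapping.single (1, 1) 1) \<and>
     (\<forall>g h. counit H (g * h) = counit H g * counit H h) \<and>
     counit H 1 = 1"

definition hopf_algebra :: "('k::field, 'h::ring_1) hopf \<Rightarrow> bool" where
  "hopf_algebra H \<longleftrightarrow> bialgebra H \<and>
     (\<forall>g h. antipode H (g + h) = antipode H g + antipode H h) \<and>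
     (\<forall>c h. antipode H (hscale H c h) = hscale H c (antipode H h)) \<and>
     (\<forall>h. lin_extend (hscale H) (\<lambda>(a, b). antipode H a * b) (sweedlerH H h) = hscale H (counit H h) 1) \<and>
     (\<forall>h. lin_extend (hscale H) (\<lambda>(a, b). a * antipode H b) (sweedlerH H h) = hscale H (counit H h) 1)"

definition subcoalgebra :: "('k::field, 'h::ring_1) hopf \<Rightarrow> 'h set \<Rightarrow> bool" where
  "subcoalgebra H C \<longleftrightarrow> module.subspace (hscale H) C \<and>
     (\<forall>c\<in>C. comult H c \<in> tensor_of (hscale H) (hscale H) C C)"

definition simple_subcoalgebra :: "('k::field, 'h::ring_1) hopf \<Rightarrow> 'h set \<Rightarrow> bool" where
  "simple_subcoalgebra H C \<longleftrightarrow> subcoalgebra H C \<and> C \<noteq> {0} \<and>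
     (\<forall>D. subcoalgebra H D \<and> D \<subseteq> C \<longrightarrow> D = {0} \<or> D = C)"

definition cosemisimple_coalgebra :: "('k::field, 'h::ring_1) hopf \<Rightarrow> bool" where
  "cosemisimple_coalgebra H \<longleftrightarrow>
     (\<exists>F. (\<forall>C\<in>F. simple_subcoalgebra H C) \<and> internal_direct_sum F UNIV)"


section \<open>Long dimodules\<close>

text \<open>The underlying vector space of an object is a subspace \<open>carrier M\<close> of an ambient vector
  space \<open>'m\<close>, and \<open>act\<close>, \<open>coact\<close> are only relevant on this subspace. Thus a subobject is an
  object with the same structure maps and a smaller carrier.\<close>

record (overloaded) ('k::field, 'h, 'm) dimodule =
  carrier :: "'m set"
  mscale :: "'k \<Rightarrow> 'm \<Rightarrow> 'm"
  act :: "'h \<Rightarrow> 'm \<Rightarrow> 'm"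
  coact :: "'m \<Rightarrow> ('m \<times> 'h \<Rightarrow>\<^sub>0 'k) set"

definition k_space :: "('k::field, 'h, 'm::ab_group_add) dimodule \<Rightarrow> bool" where
  "k_space M \<longleftrightarrow> vector_space (mscale M) \<and> module.subspace (mscale M) (carrier M)"

definition left_module :: "('k::field, 'h::ring_1) hopf \<Rightarrow> ('k, 'h, 'm::ab_group_add) dimodule \<Rightarrow> bool" where
  "left_module H M \<longleftrightarrow> k_space M \<and>
     (\<forall>m\<in>carrier M. \<forall>h. act M h m \<in> carrier M) \<and>
     (\<forall>m\<in>carrier M. \<forall>n\<in>carrier M. \<forall>h. act M h (m + n) = act M h m + act M h n) \<and>
     (\<forall>m\<in>carrier M. \<forall>g h. act M (g + h) m = act M g m + act M h m) \<and>
     (\<forall>m\<in>carrier M. \<forall>g h. act M (g * h) m = act M g (act M h m)) \<and>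
     (\<forall>m\<in>carrier M. act M 1 m = m) \<and>
     (\<forall>m\<in>carrier M. \<forall>c h. act M (hscale H c h) m = mscale M c (act M h m))"

abbreviation sweedlerM :: "('k::field, 'h, 'm) dimodule \<Rightarrow> 'm \<Rightarrow> ('m \<times> 'h \<Rightarrow>\<^sub>0 'k)" where
  "sweedlerM M m \<equiv> sweedler (carrier M \<times> UNIV) (coact M m)"

definition right_comodule :: "('k::field, 'h::ring_1) hopf \<Rightarrow> ('k, 'h, 'm::ab_group_add) dimodule \<Rightarrow> bool" where
  "right_comodule H M \<longleftrightarrow> k_space M \<and>
     (\<forall>m\<in>carrier M. coact M m \<in> tensor_of (mscale M) (hscale H) (carrier M) UNIV) \<and>
     (\<forall>m\<in>carrier M. \<forall>n\<in>carrier M.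
        coact M (m + n) = tensor2 (mscale M) (hscale H) (sweedlerM M m + sweedlerM M n)) \<and>
     (\<forall>m\<in>carrier M. \<forall>c.
        coact M (mscale M c m) = tensor2 (mscale M) (hscale H) (fscale c (sweedlerM M m))) \<and>
     (\<forall>m\<in>carrier M.
        tensor3 (mscale M) (hscale H) (hscale H)
          (lin_extend fscale (\<lambda>(n, h). lin_extend fscale (\<lambda>(n0, n1). Poly_Mapping.single (n0, n1, h) 1)
             (sweedlerM M n)) (sweedlerM M m)) =
        tensor3 (mscale M) (hscale H) (hscale H)
          (lin_extend fscale (\<lambda>(n, h). lin_extend fscale (\<lambda>(h1, h2). Poly_Mapping.single (n, h1, h2) 1)
             (sweedlerH H h)) (sweedlerM M m))) \<and>
     (\<forall>m\<in>carrier M. lin_extend (mscale M) (\<lambda>(n, h). mscale M (counit H h) n) (sweedlerM M m) = m)"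

definition long_dimodule :: "('k::field, 'h::ring_1) hopf \<Rightarrow> ('k, 'h, 'm::ab_group_add) dimodule \<Rightarrow> bool" where
  "long_dimodule H M \<longleftrightarrow> left_module H M \<and> right_comodule H M \<and>
     (\<forall>m\<in>carrier M. \<forall>h. coact M (act M h m) = tensor2 (mscale M) (hscale H)
        (lin_extend fscale (\<lambda>(m0, m1). Poly_Mapping.single (act M h m0, m1) 1) (sweedlerM M m)))"

abbreviation restrict_to :: "('k::field, 'h, 'm) dimodule \<Rightarrow> 'm set \<Rightarrow> ('k, 'h, 'm) dimodule" where
  "restrict_to M N \<equiv> M\<lparr>carrier := N\<rparr>"

definition subobject :: "('k::field, 'h::ring_1) hopf \<Rightarrow> ('k, 'h, 'm::ab_group_add) dimodule \<Rightarrow> 'm set \<Rightarrow> bool" where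
  "subobject H M N \<longleftrightarrow> N \<subseteq> carrier M \<and> long_dimodule H (restrict_to M N)"

definition simple_object :: "('k::field, 'h::ring_1) hopf \<Rightarrow> ('k, 'h, 'm::ab_group_add) dimodule \<Rightarrow> bool" where
  "simple_object H M \<longleftrightarrow> long_dimodule H M \<and> carrier M \<noteq> {0} \<and>
     (\<forall>N. subobject H M N \<longrightarrow> N = {0} \<or> N = carrier M)"

definition fin_gen_module :: "('k::field, 'h::ring_1, 'm::ab_group_add) dimodule \<Rightarrow> bool" where
  "fin_gen_module M \<longleftrightarrow>
     (\<exists>X. finite X \<and> X \<subseteq> carrier M \<and> carrier M = {\<Sum>x\<in>X. act M (g x) x |g. True})"

text \<open>The external direct sum of dimodules has componentwise structure maps, so the canonical
  bijection from the direct sum of the subobjects in \<open>F\<close> onto \<open>M\<close> is an isomorphism of dimodules.\<close>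

definition direct_sum_of_subobjects ::
  "('k::field, 'h::ring_1) hopf \<Rightarrow> ('k, 'h, 'm::ab_group_add) dimodule \<Rightarrow> 'm set set \<Rightarrow> bool" where
  "direct_sum_of_subobjects H M F \<longleftrightarrow>
     (\<forall>N\<in>F. subobject H M N) \<and> internal_direct_sum F (carrier M)"

definition semisimple_object :: "('k::field, 'h::ring_1) hopf \<Rightarrow> ('k, 'h, 'm::ab_group_add) dimodule \<Rightarrow> bool" where
  "semisimple_object H M \<longleftrightarrow>
     (\<exists>F. direct_sum_of_subobjects H M F \<and> (\<forall>N\<in>F. simple_object H (restrict_to M N)))"

text \<open>Every object whose ambient type is \<open>'m\<close> is semisimple; the type variable ranges over
  all types carrying an abelian group structure.\<close>

definition semisimple_category :: "('k::field, 'h::ring_1) hopf \<Rightarrow> 'm::ab_group_add itself \<Rightarrow> bool" where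
  "semisimple_category H _ \<longleftrightarrow>
     (\<forall>M :: ('k, 'h, 'm) dimodule. long_dimodule H M \<longrightarrow> semisimple_object H M)"

end

theory Submission
  imports Defs
begin

text \<open>
  A Long dimodule carries two commuting actions: that of \<open>H\<close>, and that of the linear functionals on
  \<open>H\<close> by \<open>f \<cdot> m = \<Sum> f(m\<^sub>1) m\<^sub>0\<close> (the constant \<open>dual\<close>). A subspace is a subobject iff
  it is stable under both (\<open>subobject_iff_stable\<close>), so the theorem becomes one about stable subspaces.

  Every stable subspace \<open>N\<close> has a stable complement by averaging twice, in the manner of Maschke. Start
  with any linear projection \<open>p\<close> onto \<open>N\<close>. Cosemisimplicity gives a functional \<open>l\<close> on \<open>H\<close> with
  \<open>l(1) = 1\<close> and \<open>\<Sum> l(h\<^sub>2) h\<^sub>1 = l(h) 1\<close>: the simple subcoalgebra that contains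
  \<open>1\<close> is \<open>k1\<close>, and \<open>l\<close> is the coordinate of that summand. Then
  \<open>P(m) = \<Sum> l(p(m\<^sub>0)\<^sub>1 S(m\<^sub>1)) p(m\<^sub>0)\<^sub>0\<close> is a colinear projection onto \<open>N\<close>.
  Semisimplicity gives \<open>t\<close> in \<open>H\<close> with \<open>h t = \<epsilon>(h) t\<close> and \<open>\<epsilon>(t) = 1\<close>: a simple left ideal on which
  the counit is not zero meets the kernel of the counit in \<open>0\<close>. Then
  \<open>A(m) = \<Sum> t\<^sub>1 P(S(t\<^sub>2) m)\<close> is \<open>H\<close>-linear, and it is still colinear because the elements of
  \<open>H\<close> act by colinear maps, which is the Long condition. Its kernel is the complement of \<open>N\<close>.

  Once all subobjects have complements, two applications of Zorn's lemma decompose the object into simple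
  subobjects (locale \<open>complemented_subgroups\<close>). For finite generation, write
  \<open>\<rho>(m) = \<Sum> m\<^sub>b \<otimes> b\<close> over finitely many elements \<open>b\<close> of a basis of \<open>H\<close>. The \<open>m\<^sub>b\<close> span a
  subcomodule containing \<open>m\<close>, so the submodule that they generate is a finitely generated subobject
  containing \<open>m\<close>, and a simple object coincides with it as soon as \<open>m\<close> is not zero.

  Sweedler notation is treated as follows. For a bilinear map \<open>\<beta>\<close> into any vector space, \<open>sw s \<beta> h\<close>
  stands for \<open>\<Sum> \<beta>(h\<^sub>1, h\<^sub>2)\<close>, and \<open>co s \<beta> m\<close> for \<open>\<Sum> \<beta>(m\<^sub>0, m\<^sub>1)\<close>. These values do
  not depend on representatives, and the axioms turn into equations between them. A calculation with
  Sweedler indices is then a chain of such equations whose side conditions only ask for multilinearity.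
\<close>

section \<open>Linear maps and the free vector space\<close>

abbreviation lin :: "('k::field \<Rightarrow> 'v::ab_group_add \<Rightarrow> 'v) \<Rightarrow> ('k \<Rightarrow> 'w::ab_group_add \<Rightarrow> 'w) \<Rightarrow> ('v \<Rightarrow> 'w) \<Rightarrow> bool" where
  "lin \<equiv> Vector_Spaces.linear"

lemma linD:
  assumes "lin s1 s2 f"
  shows "vector_space s1" "vector_space s2" "f (x + y) = f x + f y" "f (s1 c x) = s2 c (f x)"
    "f 0 = 0" "f (x - y) = f x - f y" "f (sum g I) = (\<Sum>i\<in>I. f (g i))"
  using assms module_hom.zero[of s1 s2 f] module_hom.diff[of s1 s2 f] module_hom.sum[of s1 s2 f]
  by (auto simp: Vector_Spaces.linear_iff linear_iff_module_hom[symmetric])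

lemma vector_spaceD:
  assumes "vector_space s"
  shows "s c (x + y) = s c x + s c y" "s (a + b) x = s a x + s b x" "s a (s b x) = s (a * b) x"
    "s 1 x = x" "s 0 x = 0" "s c 0 = 0" "s c (x - y) = s c x - s c y" "s c (sum g I) = (\<Sum>i\<in>I. s c (g i))"
    "s (a - b) x = s a x - s b x"
proof -
  interpret vector_space s by fact
  show "s c (x + y) = s c x + s c y" "s (a + b) x = s a x + s b x" "s a (s b x) = s (a * b) x"
    "s 1 x = x" "s 0 x = 0" "s c 0 = 0" "s c (x - y) = s c x - s c y" "s c (sum g I) = (\<Sum>i\<in>I. s c (g i))"
    "s (a - b) x = s a x - s b x"
    by (simp_all add: scale_right_distrib scale_left_distrib scale_right_diff_distrib
        scale_sum_right scale_left_diff_distrib)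
qed

lemma vector_space_mult: "vector_space ((*) :: 'k::field \<Rightarrow> 'k \<Rightarrow> 'k)"
  by unfold_locales (simp_all add: algebra_simps)

lemma subspace_iff:
  assumes "vector_space s"
  shows "module.subspace s N \<longleftrightarrow> 0 \<in> N \<and> (\<forall>x\<in>N. \<forall>y\<in>N. x + y \<in> N) \<and> (\<forall>c. \<forall>x\<in>N. s c x \<in> N)"
  using assms by (simp add: module.subspace_def module_iff_vector_space)

lemma subspaceD:
  assumes "vector_space s" "module.subspace s N"
  shows "0 \<in> N" "x \<in> N \<Longrightarrow> y \<in> N \<Longrightarrow> x + y \<in> N" "x \<in> N \<Longrightarrow> s c x \<in> N"
    "x \<in> N \<Longrightarrow> y \<in> N \<Longrightarrow> x - y \<in> N" "(\<And>i. i \<in> I \<Longrightarrow> g i \<in> N) \<Longrightarrow> sum g I \<in> N"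
proof -
  interpret vector_space s by fact
  show "0 \<in> N" "x \<in> N \<Longrightarrow> y \<in> N \<Longrightarrow> x + y \<in> N" "x \<in> N \<Longrightarrow> s c x \<in> N"
    "x \<in> N \<Longrightarrow> y \<in> N \<Longrightarrow> x - y \<in> N" "(\<And>i. i \<in> I \<Longrightarrow> g i \<in> N) \<Longrightarrow> sum g I \<in> N"
    using assms(2) by (auto intro: subspace_0 subspace_add subspace_scale subspace_diff subspace_sum)
qed

lemma exists_projection:
  assumes "vector_space s" "module.subspace s N"
  shows "\<exists>p. lin s s p \<and> (\<forall>x. p x \<in> N) \<and> (\<forall>x\<in>N. p x = x)"
proof -
  interpret vector_space_pair s s using assms(1) by (simp add: vector_space_pair_def)
  obtain g where "range g \<subseteq> N" "lin s s g" "\<forall>v\<in>N. g v = v"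
    using linear_exists_left_inverse_on[of "\<lambda>x. x" N] assms(2) vs1.linear_ident by auto
  then show ?thesis by blast
qed

text \<open>A linear endomorphism with kernel \<open>N\<close> serves as the quotient map modulo \<open>N\<close>: its values stay in a
  type that is already at hand.\<close>

lemma exists_kernel:
  assumes "vector_space s" "module.subspace s N"
  shows "\<exists>q. lin s s q \<and> (\<forall>x. q x = 0 \<longleftrightarrow> x \<in> N)"
proof -
  obtain p where p: "lin s s p" "\<forall>x. p x \<in> N" "\<forall>x\<in>N. p x = x"
    using exists_projection[OF assms] by blast
  then have "lin s s (\<lambda>x. x - p x)"
    using vector_spaceD[OF assms(1)] assms(1)
    by (auto simp: Vector_Spaces.linear_iff algebra_simps)
  moreover have "x - p x = 0 \<longleftrightarrow> x \<in> N" for x using p by (metis eq_iff_diff_eq_0)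
  ultimately show ?thesis by blast
qed

lemma exists_functional:
  assumes "vector_space s" "v \<noteq> 0"
  shows "\<exists>f. lin s (*) f \<and> f v = 1"
proof -
  interpret vector_space_pair s "(*)" using assms(1) vector_space_mult by (simp add: vector_space_pair_def)
  have "vs1.independent {v}" using assms(2) by simp
  from linear_independent_extend[OF this, of "\<lambda>_. 1"] show ?thesis by auto
qed

text \<open>Rules that show by backward reasoning that an explicitly given term is linear in one of its variables.
  In each rule the shape of the term determines the instance, so that plain introduction suffices.\<close>

named_theorems linear_intros

lemma linear_ident [linear_intros]: "vector_space s \<Longrightarrow> lin s s (\<lambda>x. x)"
  by (simp add: Vector_Spaces.linear_iff)

lemma linear_scale_right [linear_intros]:
  assumes "lin s1 s f"
  shows "lin s1 s (\<lambda>x. s c (f x))"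
  using assms vector_spaceD[OF linD(2)[OF assms]]
  by (simp add: Vector_Spaces.linear_iff mult.commute)

lemma linear_scale_left [linear_intros]:
  assumes "vector_space s" "lin s1 (*) f"
  shows "lin s1 s (\<lambda>x. s (f x) v)"
  using assms vector_spaceD[OF assms(1)] by (simp add: Vector_Spaces.linear_iff)

lemma linear_comp: "lin s2 s3 g \<Longrightarrow> lin s1 s2 f \<Longrightarrow> lin s1 s3 (\<lambda>x. g (f x))"
  by (simp add: Vector_Spaces.linear_iff)

lemma lookup_fscale [simp]: "Poly_Mapping.lookup (fscale c p) x = c * Poly_Mapping.lookup p x"
  by (simp add: fscale_def Poly_Mapping.map.rep_eq when_def)

lemma lin_extend_eq_sum:
  assumes "vector_space s" "finite I" "Poly_Mapping.keys p \<subseteq> I"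
  shows "lin_extend s f p = (\<Sum>x\<in>I. s (Poly_Mapping.lookup p x) (f x))"
  unfolding lin_extend_def using assms
  by (intro sum.mono_neutral_left) (auto simp: vector_spaceD(5)[OF assms(1)] in_keys_iff)

lemma linear_lin_extend:
  assumes s: "vector_space s"
  shows "lin fscale s (lin_extend s f)"
  unfolding Vector_Spaces.linear_iff
proof (intro conjI allI)
  show "vector_space (fscale :: 'a \<Rightarrow> ('c \<Rightarrow>\<^sub>0 'a) \<Rightarrow> _)" by (rule vector_space_fscale)
  show "vector_space s" by fact
  fix p q :: "'c \<Rightarrow>\<^sub>0 'a" and c
  let ?I = "Poly_Mapping.keys p \<union> Poly_Mapping.keys q"
  have I: "finite ?I" by simp
  show "lin_extend s f (p + q) = lin_extend s f p + lin_extend s f q"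
    using Poly_Mapping.keys_add[of p q]
    by (simp add: lin_extend_eq_sum[OF s I] lookup_add vector_spaceD[OF s] sum.distrib)
  have "Poly_Mapping.keys (fscale c p) \<subseteq> Poly_Mapping.keys p" by (auto simp: in_keys_iff)
  then show "lin_extend s f (fscale c p) = s c (lin_extend s f p)"
    by (simp add: lin_extend_eq_sum[OF s finite_keys[of p]] vector_spaceD[OF s])
qed

lemma lin_extend_single:
  assumes "vector_space s"
  shows "lin_extend s f (Poly_Mapping.single x c) = s c (f x)"
  by (subst lin_extend_eq_sum[OF assms, of "{x}"]) auto

lemma lin_extend_comp:
  assumes "lin s s' g"
  shows "g (lin_extend s f p) = lin_extend s' (\<lambda>x. g (f x)) p"
  by (simp add: lin_extend_def linD(4,7)[OF assms])

lemma lin_extend_cong: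
  "(\<And>x. x \<in> Poly_Mapping.keys p \<Longrightarrow> f x = g x) \<Longrightarrow> lin_extend s f p = lin_extend s g p"
  by (simp add: lin_extend_def)

lemma lin_extend_mem:
  assumes "vector_space s" "module.subspace s N" "\<And>x. x \<in> Poly_Mapping.keys p \<Longrightarrow> f x \<in> N"
  shows "lin_extend s f p \<in> N"
  unfolding lin_extend_def by (intro subspaceD(3,5)[OF assms(1,2)] assms(3))

lemma linear_lin_extend_param:
  assumes "vector_space s1" "vector_space s" "\<And>x. x \<in> Poly_Mapping.keys p \<Longrightarrow> lin s1 s (\<lambda>v. f v x)"
  shows "lin s1 s (\<lambda>v. lin_extend s (f v) p)"
  unfolding Vector_Spaces.linear_iff
proof (intro conjI allI)
  note f = linD(3,4)[OF assms(3)] and s = vector_spaceD[OF assms(2)]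
  fix v w c
  show "lin_extend s (f (v + w)) p = lin_extend s (f v) p + lin_extend s (f w) p"
    by (simp add: lin_extend_def f s sum.distrib)
  show "lin_extend s (f (s1 c v)) p = s c (lin_extend s (f v) p)"
    by (simp add: lin_extend_def f s mult.commute)
qed fact+

lemma lin_extend_swap:
  assumes s: "vector_space s"
  shows "lin_extend s (\<lambda>x. lin_extend s (\<lambda>y. f x y) q) p = lin_extend s (\<lambda>y. lin_extend s (\<lambda>x. f x y) p) q"
  unfolding lin_extend_def vector_spaceD(8,3)[OF s]
  by (rule trans[OF sum.swap]) (intro sum.cong refl arg_cong2[where f = s] mult.commute)

lemma lin_extend_free:
  fixes p :: "'x \<Rightarrow>\<^sub>0 'k::field"
  shows "lin_extend fscale (\<lambda>x. Poly_Mapping.single x 1) p = p"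
proof -
  have "fscale c (Poly_Mapping.single x 1) = Poly_Mapping.single x c" for c :: 'k and x :: 'x
    by (rule poly_mapping_eqI) (simp add: lookup_single when_def)
  then have "lin_extend fscale (\<lambda>x. Poly_Mapping.single x 1) p =
      (\<Sum>x\<in>Poly_Mapping.keys p. Poly_Mapping.single x (Poly_Mapping.lookup p x))"
    by (simp add: lin_extend_def)
  also have "\<dots> = p"
    by (rule poly_mapping_eqI)
      (simp add: lookup_sum lookup_single when_def sum.delta' in_keys_iff)
  finally show ?thesis .
qed

text \<open>A linear map on the free vector space is the linear extension of its values on the generators.\<close>

lemma linear_on_free:
  assumes "lin fscale s q"
  shows "q x = lin_extend s (\<lambda>z. q (Poly_Mapping.single z 1)) x"
  using arg_cong[OF lin_extend_free[of x], of q] unfolding lin_extend_comp[OF assms] by simp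

lemma lin_extend_sum:
  assumes "vector_space s"
  shows "lin_extend s (\<lambda>x. \<Sum>i\<in>I. f i x) p = (\<Sum>i\<in>I. lin_extend s (f i) p)"
  unfolding lin_extend_def vector_spaceD(8)[OF assms] by (rule sum.swap)

lemma lin_extend_comp2:
  assumes "lin s s' g"
  shows "g (lin_extend s (\<lambda>(a, b). \<beta> a b) p) = lin_extend s' (\<lambda>(a, b). g (\<beta> a b)) p"
  unfolding lin_extend_comp[OF assms] by (rule lin_extend_cong) (simp add: case_prod_unfold)

lemma lin_extend_swap2:
  assumes "vector_space s"
  shows "lin_extend s (\<lambda>(a, b). lin_extend s (\<lambda>(c, d). \<beta> a b c d) q) p =
    lin_extend s (\<lambda>(c, d). lin_extend s (\<lambda>(a, b). \<beta> a b c d) p) q"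
  using lin_extend_swap[OF assms, of "\<lambda>x y. \<beta> (fst x) (snd x) (fst y) (snd y)" q p]
  by (simp add: case_prod_unfold)

section \<open>Multilinear maps and tensors\<close>


definition bilin where
  "bilin s1 s2 s \<beta> \<longleftrightarrow> (\<forall>v. lin s2 s (\<lambda>w. \<beta> v w)) \<and> (\<forall>w. lin s1 s (\<lambda>v. \<beta> v w))"

definition trilin where
  "trilin s1 s2 s3 s \<tau> \<longleftrightarrow> (\<forall>v w. lin s1 s (\<lambda>u. \<tau> u v w)) \<and> (\<forall>u w. lin s2 s (\<lambda>v. \<tau> u v w)) \<and>
     (\<forall>u v. lin s3 s (\<lambda>w. \<tau> u v w))"

lemma bilinI:
  "(\<And>w. lin s1 s (\<lambda>v. \<beta> v w)) \<Longrightarrow> (\<And>v. lin s2 s (\<lambda>w. \<beta> v w)) \<Longrightarrow> bilin s1 s2 s \<beta>"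
  by (simp add: bilin_def)

lemma bilinD:
  assumes "bilin s1 s2 s \<beta>"
  shows "vector_space s" "vector_space s1" "vector_space s2"
    "lin s' s1 f \<Longrightarrow> lin s' s (\<lambda>x. \<beta> (f x) w)" "lin s' s2 g \<Longrightarrow> lin s' s (\<lambda>x. \<beta> v (g x))"
proof -
  have l: "lin s1 s (\<lambda>v. \<beta> v w)" for w using assms by (simp add: bilin_def)
  have r: "lin s2 s (\<lambda>w. \<beta> v w)" for v using assms by (simp add: bilin_def)
  show "vector_space s" "vector_space s1" "vector_space s2" using linD(2,1)[OF l] linD(1)[OF r] by this+
  show "lin s' s1 f \<Longrightarrow> lin s' s (\<lambda>x. \<beta> (f x) w)" by (rule linear_comp[OF l])
  show "lin s' s2 g \<Longrightarrow> lin s' s (\<lambda>x. \<beta> v (g x))" by (rule linear_comp[OF r])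
qed

lemma trilinI:
  "(\<And>v w. lin s1 s (\<lambda>u. \<tau> u v w)) \<Longrightarrow> (\<And>u w. lin s2 s (\<lambda>v. \<tau> u v w)) \<Longrightarrow>
   (\<And>u v. lin s3 s (\<lambda>w. \<tau> u v w)) \<Longrightarrow> trilin s1 s2 s3 s \<tau>"
  by (simp add: trilin_def)

lemma linear_relations_vanish:
  assumes "lin s1 s (\<lambda>v. f (e v))" "x \<in> linear_relations s1 e"
  shows "lin_extend s f x = 0"
proof -
  note s = linD(2)[OF assms(1)] and f = linD(3,4)[OF assms(1)]
  note l = linD(6)[OF linear_lin_extend[OF s, of f]]
  note l' = lin_extend_single[OF s] vector_spaceD(4)[OF s]
  have "lin_extend s f (Poly_Mapping.single (e (v + w)) 1 - Poly_Mapping.single (e v) 1 - Poly_Mapping.single (e w) 1) = 0"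
    for v w unfolding l l' f by simp
  moreover have "lin_extend s f (Poly_Mapping.single (e (s1 c v)) 1 - Poly_Mapping.single (e v) c) = 0"
    for c v unfolding l l' f by simp
  ultimately show ?thesis using assms(2) unfolding linear_relations_def by blast
qed

text \<open>Conversely to the preceding lemma, a linear map on the free vector space that kills the relations is
  linear in the variable to which they refer.\<close>

lemma linear_of_linear_relations:
  assumes e: "\<And>z. z \<in> linear_relations s1 e \<Longrightarrow> q z = 0" and q: "lin fscale s q" and s1: "vector_space s1"
  shows "lin s1 s (\<lambda>v. q (Poly_Mapping.single (e v) 1))"
  unfolding Vector_Spaces.linear_iff
proof (intro conjI allI)
  fix v w c
  have "Poly_Mapping.single (e (v + w)) 1 - Poly_Mapping.single (e v) 1 - Poly_Mapping.single (e w) 1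
      \<in> linear_relations s1 e" by (auto simp: linear_relations_def)
  from e[OF this] show "q (Poly_Mapping.single (e (v + w)) 1) =
      q (Poly_Mapping.single (e v) 1) + q (Poly_Mapping.single (e w) 1)"
    by (simp add: linD[OF q] algebra_simps)
  have "Poly_Mapping.single (e (s1 c v)) 1 - Poly_Mapping.single (e v) c \<in> linear_relations s1 e"
    by (auto simp: linear_relations_def)
  moreover have "Poly_Mapping.single (e v) c = fscale c (Poly_Mapping.single (e v) 1)"
    by (rule poly_mapping_eqI) (simp add: lookup_single when_def)
  ultimately show "q (Poly_Mapping.single (e (s1 c v)) 1) = s c (q (Poly_Mapping.single (e v) 1))"
    using e linD[OF q] by (metis eq_iff_diff_eq_0)
qed (use s1 linD[OF q] in auto)

lemma span_vanish:
  fixes q :: "('x \<Rightarrow>\<^sub>0 'k::field) \<Rightarrow> 'w::ab_group_add"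
  assumes q: "lin fscale s q" and X: "\<And>z. z \<in> X \<Longrightarrow> q z = 0" and x: "x \<in> module.span fscale X"
  shows "q x = 0"
proof -
  have m: "module (fscale :: 'k \<Rightarrow> ('x \<Rightarrow>\<^sub>0 'k) \<Rightarrow> _)"
    using vector_space_fscale by (simp add: module_iff_vector_space)
  have "module.subspace fscale (Collect (\<lambda>x. q x = 0))"
    using linD[OF q] vector_spaceD[OF linD(2)[OF q]] by (simp add: subspace_iff[OF vector_space_fscale])
  then show ?thesis using module.span_induct[OF m x, of "\<lambda>x. q x = 0"] X by blast
qed

lemma relations2_vanish:
  assumes "bilin s1 s2 s \<beta>" "x \<in> relations2 s1 s2"
  shows "lin_extend s (\<lambda>(v, w). \<beta> v w) x = 0"
proof (rule span_vanish[OF _ _ assms(2)[unfolded relations2_def]])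
  have "vector_space s" using assms(1) unfolding bilin_def by (blast dest: linD(2))
  then show "lin fscale s (lin_extend s (\<lambda>(v, w). \<beta> v w))" by (rule linear_lin_extend)
  fix z assume "z \<in> (\<Union>w. linear_relations s1 (\<lambda>v. (v, w))) \<union> (\<Union>v. linear_relations s2 (\<lambda>w. (v, w)))"
  then consider w where "z \<in> linear_relations s1 (\<lambda>v. (v, w))"
    | v where "z \<in> linear_relations s2 (\<lambda>w. (v, w))" by blast
  then show "lin_extend s (\<lambda>(v, w). \<beta> v w) z = 0"
    by cases (erule linear_relations_vanish[rotated], use assms(1) in \<open>simp add: bilin_def\<close>)+
qed

lemma relations3_vanish:
  assumes "trilin s1 s2 s3 s \<tau>" "x \<in> relations3 s1 s2 s3"
  shows "lin_extend s (\<lambda>(u, v, w). \<tau> u v w) x = 0"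
proof (rule span_vanish[OF _ _ assms(2)[unfolded relations3_def]])
  have "vector_space s" using assms(1) unfolding trilin_def by (blast dest: linD(2))
  then show "lin fscale s (lin_extend s (\<lambda>(u, v, w). \<tau> u v w))" by (rule linear_lin_extend)
  fix z assume "z \<in> (\<Union>v w. linear_relations s1 (\<lambda>u. (u, v, w))) \<union>
      (\<Union>u w. linear_relations s2 (\<lambda>v. (u, v, w))) \<union> (\<Union>u v. linear_relations s3 (\<lambda>w. (u, v, w)))"
  then consider v w where "z \<in> linear_relations s1 (\<lambda>u. (u, v, w))"
    | u w where "z \<in> linear_relations s2 (\<lambda>v. (u, v, w))"
    | u v where "z \<in> linear_relations s3 (\<lambda>w. (u, v, w))" by blast
  then show "lin_extend s (\<lambda>(u, v, w). \<tau> u v w) z = 0"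
    by cases (erule linear_relations_vanish[rotated], use assms(1) in \<open>simp add: trilin_def\<close>)+
qed

lemma subspace_relations:
  "module.subspace fscale (relations2 s1 s2)" "module.subspace fscale (relations3 s1 s2 s3)"
  using vector_space_fscale module.subspace_span
  unfolding relations2_def relations3_def module_iff_vector_space[symmetric] by blast+

text \<open>Tensors are cosets, so their equality is membership of a difference in the space of relations.\<close>

lemma coset_eq_iff:
  assumes "module.subspace fscale W"
  shows "{y. y - x \<in> W} = {y. y - x' \<in> W} \<longleftrightarrow> x - x' \<in> W"
proof
  note W = subspaceD[OF vector_space_fscale assms]
  have "x \<in> {y. y - x \<in> W}" using W by simp
  then show "{y. y - x \<in> W} = {y. y - x' \<in> W} \<Longrightarrow> x - x' \<in> W" by blast
  assume d: "x - x' \<in> W"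
  have "y - x \<in> W \<longleftrightarrow> y - x' \<in> W" for y
    using W(2)[OF _ d, of "y - x"] W(4)[OF _ d, of "y - x'"] by auto
  then show "{y. y - x \<in> W} = {y. y - x' \<in> W}" by blast
qed

lemma tensor2_eq_iff: "tensor2 s1 s2 x = tensor2 s1 s2 y \<longleftrightarrow> x - y \<in> relations2 s1 s2"
  unfolding tensor2_def by (rule coset_eq_iff[OF subspace_relations(1)])

lemma tensor3_eq_iff: "tensor3 s1 s2 s3 x = tensor3 s1 s2 s3 y \<longleftrightarrow> x - y \<in> relations3 s1 s2 s3"
  unfolding tensor3_def by (rule coset_eq_iff[OF subspace_relations(2)])

lemma tensor2_self: "x \<in> tensor2 s1 s2 x"
  using subspaceD(1)[OF vector_space_fscale subspace_relations(1)] by (simp add: tensor2_def)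

lemma tensor2_eqI: "y \<in> tensor2 s1 s2 x \<Longrightarrow> tensor2 s1 s2 y = tensor2 s1 s2 x"
  unfolding tensor2_eq_iff by (simp add: tensor2_def)

lemma tensor2_cong:
  assumes "tensor2 s1 s2 x = tensor2 s1 s2 x'"
  shows "tensor2 s1 s2 y = tensor2 s1 s2 y' \<Longrightarrow> tensor2 s1 s2 (x + y) = tensor2 s1 s2 (x' + y')"
    "tensor2 s1 s2 (fscale c x) = tensor2 s1 s2 (fscale c x')"
proof -
  note R = subspaceD[OF vector_space_fscale subspace_relations(1)]
  have "(x + y) - (x' + y') = (x - x') + (y - y')" by simp
  then show "tensor2 s1 s2 y = tensor2 s1 s2 y' \<Longrightarrow> tensor2 s1 s2 (x + y) = tensor2 s1 s2 (x' + y')"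
    using assms R(2) unfolding tensor2_eq_iff by metis
  have "fscale c x - fscale c x' = fscale c (x - x')"
    by (rule vector_spaceD(7)[OF vector_space_fscale, symmetric])
  then show "tensor2 s1 s2 (fscale c x) = tensor2 s1 s2 (fscale c x')"
    using assms R(3) unfolding tensor2_eq_iff by metis
qed

lemma lin_extend_tensor2:
  assumes "bilin s1 s2 s \<beta>" "tensor2 s1 s2 x = tensor2 s1 s2 y"
  shows "lin_extend s (\<lambda>(v, w). \<beta> v w) x = lin_extend s (\<lambda>(v, w). \<beta> v w) y"
proof -
  have "vector_space s" using assms(1) unfolding bilin_def by (blast dest: linD(2))
  note l = linD(6)[OF linear_lin_extend[OF this]]
  have "lin_extend s (\<lambda>(v, w). \<beta> v w) (x - y) = 0"
    using assms(2) unfolding tensor2_eq_iff by (rule relations2_vanish[OF assms(1)])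
  then show ?thesis unfolding l by simp
qed

lemma lin_extend_tensor3:
  assumes "trilin s1 s2 s3 s \<tau>" "tensor3 s1 s2 s3 x = tensor3 s1 s2 s3 y"
  shows "lin_extend s (\<lambda>(u, v, w). \<tau> u v w) x = lin_extend s (\<lambda>(u, v, w). \<tau> u v w) y"
proof -
  have "vector_space s" using assms(1) unfolding trilin_def by (blast dest: linD(2))
  note l = linD(6)[OF linear_lin_extend[OF this]]
  have "lin_extend s (\<lambda>(u, v, w). \<tau> u v w) (x - y) = 0"
    using assms(2) unfolding tensor3_eq_iff by (rule relations3_vanish[OF assms(1)])
  then show ?thesis unfolding l by simp
qed

text \<open>Equality in a tensor product is detected by one multilinear map with values in the free
  vector space, namely a linear map whose kernel is the space of relations.\<close>

lemma exists_universal_bilinear: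
  fixes s1 :: "'k::field \<Rightarrow> 'u::ab_group_add \<Rightarrow> 'u" and s2 :: "'k \<Rightarrow> 'v::ab_group_add \<Rightarrow> 'v"
  assumes "vector_space s1" "vector_space s2"
  shows "\<exists>q :: ('u \<times> 'v \<Rightarrow>\<^sub>0 'k) \<Rightarrow> ('u \<times> 'v \<Rightarrow>\<^sub>0 'k).
     lin fscale fscale q \<and> bilin s1 s2 fscale (\<lambda>v w. q (Poly_Mapping.single (v, w) 1)) \<and>
     (\<forall>x y. tensor2 s1 s2 x = tensor2 s1 s2 y \<longleftrightarrow> q x = q y)"
proof -
  obtain q :: "('u \<times> 'v \<Rightarrow>\<^sub>0 'k) \<Rightarrow> ('u \<times> 'v \<Rightarrow>\<^sub>0 'k)"
    where q: "lin fscale fscale q" "\<And>x. q x = 0 \<longleftrightarrow> x \<in> relations2 s1 s2"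
    using exists_kernel[OF vector_space_fscale subspace_relations(1)] by blast
  have m: "module (fscale :: 'k \<Rightarrow> ('u \<times> 'v \<Rightarrow>\<^sub>0 'k) \<Rightarrow> _)"
    using vector_space_fscale by (simp add: module_iff_vector_space)
  have "bilin s1 s2 fscale (\<lambda>v w. q (Poly_Mapping.single (v, w) 1))"
    unfolding bilin_def
    by (intro conjI allI linear_of_linear_relations[OF _ q(1)] assms)
      (unfold q(2) relations2_def, (rule module.span_base[OF m], blast)+)
  moreover have "tensor2 s1 s2 x = tensor2 s1 s2 y \<longleftrightarrow> q x = q y" for x y
    unfolding tensor2_eq_iff q(2)[symmetric] linD(6)[OF q(1)] by simp
  ultimately show ?thesis using q(1) by blast
qed

lemma exists_universal_trilinear:
  fixes s1 :: "'k::field \<Rightarrow> 'u::ab_group_add \<Rightarrow> 'u" and s2 :: "'k \<Rightarrow> 'v::ab_group_add \<Rightarrow> 'v"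
    and s3 :: "'k \<Rightarrow> 'w::ab_group_add \<Rightarrow> 'w"
  assumes "vector_space s1" "vector_space s2" "vector_space s3"
  shows "\<exists>q :: ('u \<times> 'v \<times> 'w \<Rightarrow>\<^sub>0 'k) \<Rightarrow> ('u \<times> 'v \<times> 'w \<Rightarrow>\<^sub>0 'k).
     lin fscale fscale q \<and> trilin s1 s2 s3 fscale (\<lambda>u v w. q (Poly_Mapping.single (u, v, w) 1)) \<and>
     (\<forall>x y. tensor3 s1 s2 s3 x = tensor3 s1 s2 s3 y \<longleftrightarrow> q x = q y)"
proof -
  obtain q :: "('u \<times> 'v \<times> 'w \<Rightarrow>\<^sub>0 'k) \<Rightarrow> ('u \<times> 'v \<times> 'w \<Rightarrow>\<^sub>0 'k)"
    where q: "lin fscale fscale q" "\<And>x. q x = 0 \<longleftrightarrow> x \<in> relations3 s1 s2 s3"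
    using exists_kernel[OF vector_space_fscale subspace_relations(2)] by blast
  have m: "module (fscale :: 'k \<Rightarrow> ('u \<times> 'v \<times> 'w \<Rightarrow>\<^sub>0 'k) \<Rightarrow> _)"
    using vector_space_fscale by (simp add: module_iff_vector_space)
  have "trilin s1 s2 s3 fscale (\<lambda>u v w. q (Poly_Mapping.single (u, v, w) 1))"
    unfolding trilin_def
  proof (intro conjI allI linear_of_linear_relations[OF _ q(1)] assms; unfold q(2) relations3_def;
      rule module.span_base[OF m])
    fix z u v w
    let ?R1 = "\<Union>v w. linear_relations s1 (\<lambda>u. (u, v, w))" and ?R2 = "\<Union>u w. linear_relations s2 (\<lambda>v. (u, v, w))"
      and ?R3 = "\<Union>u v. linear_relations s3 (\<lambda>w. (u, v, w))"
    show "z \<in> linear_relations s1 (\<lambda>u. (u, v, w)) \<Longrightarrow> z \<in> ?R1 \<union> ?R2 \<union> ?R3"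
      by (intro UnI1 UN_I[OF UNIV_I])
    show "z \<in> linear_relations s2 (\<lambda>v. (u, v, w)) \<Longrightarrow> z \<in> ?R1 \<union> ?R2 \<union> ?R3"
      by (rule UnI1, rule UnI2, intro UN_I[OF UNIV_I])
    show "z \<in> linear_relations s3 (\<lambda>w. (u, v, w)) \<Longrightarrow> z \<in> ?R1 \<union> ?R2 \<union> ?R3"
      by (rule UnI2, intro UN_I[OF UNIV_I])
  qed
  moreover have "tensor3 s1 s2 s3 x = tensor3 s1 s2 s3 y \<longleftrightarrow> q x = q y" for x y
    unfolding tensor3_eq_iff q(2)[symmetric] linD(6)[OF q(1)] by simp
  ultimately show ?thesis using q(1) by blast
qed

lemma sweedler_in_tensor_of:
  assumes "t \<in> tensor_of s1 s2 A B"
  shows "tensor2 s1 s2 (sweedler (A \<times> B) t) = t" "Poly_Mapping.keys (sweedler (A \<times> B) t) \<subseteq> A \<times> B"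
proof -
  obtain x where x: "t = tensor2 s1 s2 x" "Poly_Mapping.keys x \<subseteq> A \<times> B"
    using assms by (auto simp: tensor_of_def)
  then have "\<exists>x. x \<in> t \<and> Poly_Mapping.keys x \<subseteq> A \<times> B" using tensor2_self by blast
  from someI_ex[OF this] have "sweedler (A \<times> B) t \<in> t" "Poly_Mapping.keys (sweedler (A \<times> B) t) \<subseteq> A \<times> B"
    by (auto simp: sweedler_def)
  then show "tensor2 s1 s2 (sweedler (A \<times> B) t) = t" "Poly_Mapping.keys (sweedler (A \<times> B) t) \<subseteq> A \<times> B"
    using x(1) tensor2_eqI by blast+
qed


section \<open>Families of subgroups with complements\<close>

text \<open>Complements, independence and simplicity only involve the additive structure, so they are treated
  for subsets of an abelian group.\<close>

definition additive_subgroup :: "'a::ab_group_add set \<Rightarrow> bool" where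
  "additive_subgroup N \<longleftrightarrow> 0 \<in> N \<and> (\<forall>x\<in>N. \<forall>y\<in>N. x - y \<in> N)"

lemma additive_subgroupD:
  assumes "additive_subgroup N"
  shows "0 \<in> N" "x \<in> N \<Longrightarrow> y \<in> N \<Longrightarrow> x - y \<in> N" "x \<in> N \<Longrightarrow> - x \<in> N"
    "x \<in> N \<Longrightarrow> y \<in> N \<Longrightarrow> x + y \<in> N"
proof -
  show z: "0 \<in> N" and d: "\<And>x y. x \<in> N \<Longrightarrow> y \<in> N \<Longrightarrow> x - y \<in> N"
    using assms by (auto simp: additive_subgroup_def)
  show m: "- x \<in> N" if "x \<in> N" for x using d[OF z that] by simp
  show "x + y \<in> N" if "x \<in> N" "y \<in> N" using d[OF that(1) m[OF that(2)]] by simp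
qed

text \<open>This is the summation map on finitely supported families that occurs in the definition of an internal
  direct sum.\<close>

definition support_sum :: "('i \<Rightarrow> 'a::ab_group_add) \<Rightarrow> 'a" where
  "support_sum f = (\<Sum>i | f i \<noteq> 0. f i)"

lemma support_sum_eq_sum:
  assumes "finite I" "{i. f i \<noteq> 0} \<subseteq> I"
  shows "support_sum f = sum f I"
  unfolding support_sum_def using assms by (intro sum.mono_neutral_left) auto

lemma support_sum_add:
  assumes "finite {i. f i \<noteq> 0}" "finite {i. g i \<noteq> 0}"
  shows "support_sum (\<lambda>i. f i + g i) = support_sum f + support_sum g"
proof -
  let ?I = "{i. f i \<noteq> 0} \<union> {i. g i \<noteq> 0}"
  have "support_sum (\<lambda>i. f i + g i) = (\<Sum>i\<in>?I. f i + g i)"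
    using assms by (intro support_sum_eq_sum) auto
  also have "\<dots> = support_sum f + support_sum g"
    using assms support_sum_eq_sum[of ?I f] support_sum_eq_sum[of ?I g] by (auto simp: sum.distrib)
  finally show ?thesis .
qed

lemma support_sum_minus: "support_sum (\<lambda>i. - f i) = - support_sum f"
  by (simp add: support_sum_def sum_negf)

lemma support_sum_single: "support_sum (\<lambda>i. if i = j then a else 0) = a"
  by (subst support_sum_eq_sum[where I = "{j}"]) auto

lemma direct_sum_carrier_add:
  assumes "\<forall>N\<in>F. additive_subgroup N" "f \<in> direct_sum_carrier F" "g \<in> direct_sum_carrier F"
  shows "(\<lambda>N. f N + g N) \<in> direct_sum_carrier F"
proof -
  have "{N. f N + g N \<noteq> 0} \<subseteq> {N. f N \<noteq> 0} \<union> {N. g N \<noteq> 0}" by auto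
  then have "finite {N. f N + g N \<noteq> 0}"
    using assms by (auto simp: direct_sum_carrier_def intro: finite_subset)
  then show ?thesis
    using assms by (auto simp: direct_sum_carrier_def additive_subgroupD)
qed

lemma direct_sum_carrier_uminus:
  assumes "\<forall>N\<in>F. additive_subgroup N" "f \<in> direct_sum_carrier F"
  shows "(\<lambda>N. - f N) \<in> direct_sum_carrier F"
  using assms by (simp add: direct_sum_carrier_def additive_subgroupD(3))

lemma direct_sum_carrier_single:
  assumes "\<forall>N\<in>F. additive_subgroup N" "S \<in> F" "a \<in> S"
  shows "(\<lambda>N. if N = S then a else 0) \<in> direct_sum_carrier F"
proof -
  have "{N. (if N = S then a else 0) \<noteq> 0} \<subseteq> {S}" by auto
  then have "finite {N. (if N = S then a else 0) \<noteq> 0}" by (rule finite_subset) simp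
  then show ?thesis using assms by (simp add: direct_sum_carrier_def additive_subgroupD(1))
qed

definition independent_family :: "'a::ab_group_add set set \<Rightarrow> bool" where
  "independent_family F \<longleftrightarrow> (\<forall>f\<in>direct_sum_carrier F. support_sum f = 0 \<longrightarrow> f = (\<lambda>_. 0))"

definition family_sum :: "'a::ab_group_add set set \<Rightarrow> 'a set" where
  "family_sum F = support_sum ` direct_sum_carrier F"

lemma internal_direct_sumI:
  assumes "\<forall>N\<in>F. additive_subgroup N" "independent_family F" "family_sum F = V"
  shows "internal_direct_sum F V"
proof -
  have "f = g" if f: "f \<in> direct_sum_carrier F" and g: "g \<in> direct_sum_carrier F"
    and eq: "support_sum f = support_sum g" for f g
  proof -
    have "(\<lambda>N. f N + - g N) \<in> direct_sum_carrier F"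
      using direct_sum_carrier_add[OF assms(1) f direct_sum_carrier_uminus[OF assms(1) g]] .
    moreover have "support_sum (\<lambda>N. f N + - g N) = support_sum f + - support_sum g"
      using f g by (subst support_sum_add) (auto simp: direct_sum_carrier_def support_sum_minus)
    ultimately have "(\<lambda>N. f N + - g N) = (\<lambda>_. 0)"
      using assms(2) eq by (auto simp: independent_family_def)
    then show ?thesis by (auto simp: fun_eq_iff)
  qed
  then show ?thesis
    using assms(3) unfolding internal_direct_sum_def bij_betw_def family_sum_def inj_on_def
    by (auto simp: support_sum_def)
qed

lemma support_sum_split:
  assumes "finite {N. f N \<noteq> 0}"
  shows "support_sum f = f S + support_sum (f(S := 0))"
proof -
  have "support_sum f = support_sum (\<lambda>N. (if N = S then f S else 0) + (f(S := 0)) N)"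
    by (rule arg_cong[where f = support_sum]) auto
  also have "\<dots> = f S + support_sum (f(S := 0))"
    using assms by (subst support_sum_add) (auto simp: support_sum_single intro: finite_subset)
  finally show ?thesis .
qed

lemma direct_sum_carrier_delete:
  assumes "f \<in> direct_sum_carrier (insert S F)" "\<forall>N\<in>F. additive_subgroup N" "S \<notin> F"
  shows "f(S := 0) \<in> direct_sum_carrier F"
proof -
  have "finite {N. (f(S := 0)) N \<noteq> 0}"
    using assms(1) by (auto simp: direct_sum_carrier_def elim!: rev_finite_subset)
  then show ?thesis using assms by (auto simp: direct_sum_carrier_def)
qed

lemma family_sum_insert:
  assumes "\<forall>N\<in>insert S F. additive_subgroup N" "S \<notin> F"
  shows "family_sum (insert S F) = {a + b | a b. a \<in> S \<and> b \<in> family_sum F}"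
proof (intro subset_antisym subsetI)
  fix x assume "x \<in> family_sum (insert S F)"
  then obtain f where f: "f \<in> direct_sum_carrier (insert S F)" "x = support_sum f"
    by (auto simp: family_sum_def)
  then have "x = f S + support_sum (f(S := 0))" "f S \<in> S"
    using support_sum_split[of f S] by (auto simp: direct_sum_carrier_def)
  then show "x \<in> {a + b | a b. a \<in> S \<and> b \<in> family_sum F}"
    using direct_sum_carrier_delete[OF f(1)] assms by (auto simp: family_sum_def)
next
  fix x assume "x \<in> {a + b | a b. a \<in> S \<and> b \<in> family_sum F}"
  then obtain a f where f: "f \<in> direct_sum_carrier F" "x = a + support_sum f" "a \<in> S"
    by (auto simp: family_sum_def)
  have fin: "finite {N. (f(S := a)) N \<noteq> 0}"
    using f(1) by (auto simp: direct_sum_carrier_def intro: rev_finite_subset[of "insert S {N. f N \<noteq> 0}"])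
  have "f S = 0" using f(1) assms(2) by (auto simp: direct_sum_carrier_def)
  then have "(f(S := a))(S := 0) = f" by auto
  then have "support_sum (f(S := a)) = x" using support_sum_split[OF fin, of S] f by (simp del: fun_upd_apply add: fun_upd_same)
  moreover have "f(S := a) \<in> direct_sum_carrier (insert S F)"
    using f fin by (auto simp: direct_sum_carrier_def)
  ultimately show "x \<in> family_sum (insert S F)" unfolding family_sum_def by blast
qed

lemma direct_sum_carrier_restrict:
  assumes "f \<in> direct_sum_carrier F" "{N. f N \<noteq> 0} \<subseteq> G" "G \<subseteq> F"
  shows "f \<in> direct_sum_carrier G"
proof -
  have "f N \<in> N" if "N \<in> G" for N
    using assms that unfolding direct_sum_carrier_def by blast
  moreover have "f N = 0" if "N \<notin> G" for N
    using assms(2) that by blast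
  ultimately show ?thesis using assms(1) unfolding direct_sum_carrier_def by blast
qed

lemma direct_sum_carrier_mono:
  assumes "f \<in> direct_sum_carrier G" "G \<subseteq> F" "\<forall>N\<in>F. 0 \<in> N"
  shows "f \<in> direct_sum_carrier F"
proof -
  have "f N \<in> N" if "N \<in> F" for N
    using assms that unfolding direct_sum_carrier_def by (cases "N \<in> G") auto
  moreover have "f N = 0" if "N \<notin> F" for N
    using assms that unfolding direct_sum_carrier_def by blast
  ultimately show ?thesis using assms(1) unfolding direct_sum_carrier_def by blast
qed

text \<open>The order-theoretic content of semisimplicity. The members of the family play the role of
  subobjects. Complements within the whole group yield complements within every member
  by the modular law, and Zorn's lemma is applied twice: once to find a simple member below every
  nonzero member, and once to find a maximal independent family of simple members.\<close>

locale complemented_subgroups =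
  fixes \<S> :: "'a::ab_group_add set set" and V :: "'a set"
  assumes subgroup: "N \<in> \<S> \<Longrightarrow> additive_subgroup N"
    and bounded: "N \<in> \<S> \<Longrightarrow> N \<subseteq> V"
    and zero: "{0} \<in> \<S>"
    and add: "A \<in> \<S> \<Longrightarrow> B \<in> \<S> \<Longrightarrow> {a + b | a b. a \<in> A \<and> b \<in> B} \<in> \<S>"
    and int: "A \<in> \<S> \<Longrightarrow> B \<in> \<S> \<Longrightarrow> A \<inter> B \<in> \<S>"
    and directed_Union: "D \<subseteq> \<S> \<Longrightarrow> D \<noteq> {} \<Longrightarrow>
      (\<And>A B. A \<in> D \<Longrightarrow> B \<in> D \<Longrightarrow> \<exists>C\<in>D. A \<union> B \<subseteq> C) \<Longrightarrow> \<Union>D \<in> \<S>"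
    and complement: "A \<in> \<S> \<Longrightarrow> \<exists>B\<in>\<S>. A \<inter> B = {0} \<and> V = {a + b | a b. a \<in> A \<and> b \<in> B}"
begin

definition simple :: "'a set \<Rightarrow> bool" where
  "simple N \<longleftrightarrow> N \<in> \<S> \<and> N \<noteq> {0} \<and> (\<forall>K\<in>\<S>. K \<subseteq> N \<longrightarrow> K = {0} \<or> K = N)"

lemma relative_complement:
  assumes A: "A \<in> \<S>" and N: "N \<in> \<S>" and AN: "A \<subseteq> N"
  shows "\<exists>B\<in>\<S>. B \<subseteq> N \<and> A \<inter> B = {0} \<and> N = {a + b | a b. a \<in> A \<and> b \<in> B}"
proof -
  obtain B where B: "B \<in> \<S>" "A \<inter> B = {0}" "V = {a + b | a b. a \<in> A \<and> b \<in> B}"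
    using complement[OF A] by blast
  have "N \<subseteq> {a + b | a b. a \<in> A \<and> b \<in> B \<inter> N}"
  proof
    fix x assume x: "x \<in> N"
    then obtain a b where ab: "a \<in> A" "b \<in> B" "x = a + b"
      using B(3) bounded[OF N] by blast
    have "b = x - a" using ab by simp
    moreover have "a \<in> N" using ab AN by auto
    ultimately have "b \<in> N" using x additive_subgroupD(2)[OF subgroup[OF N]] by simp
    then show "x \<in> {a + b | a b. a \<in> A \<and> b \<in> B \<inter> N}" using ab by blast
  qed
  moreover have "{a + b | a b. a \<in> A \<and> b \<in> B \<inter> N} \<subseteq> N"
    using AN additive_subgroupD(4)[OF subgroup[OF N]] by auto
  ultimately have "N = {a + b | a b. a \<in> A \<and> b \<in> B \<inter> N}" by (rule subset_antisym)
  moreover have "A \<inter> (B \<inter> N) = {0}"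
    using B(2) additive_subgroupD(1)[OF subgroup[OF N]] by auto
  ultimately show ?thesis
    using int[OF B(1) N] by (intro bexI[of _ "B \<inter> N"] conjI) simp_all
qed

lemma chain_Union:
  assumes "C \<noteq> {}" "subset.chain \<S> C"
  shows "\<Union>C \<in> \<S>"
proof (rule directed_Union)
  show "C \<subseteq> \<S>" using assms by (auto simp: subset.chain_def)
  show "\<exists>E\<in>C. A \<union> B \<subseteq> E" if "A \<in> C" "B \<in> C" for A B
  proof -
    have "A \<subseteq> B \<or> B \<subseteq> A" using assms(2) that by (auto simp: subset_chain_def)
    then show ?thesis using that by (metis Un_absorb1 Un_absorb2 order_refl)
  qed
qed fact

text \<open>A complement \<open>B\<close> in \<open>N\<close> of a member \<open>K\<close> below \<open>N\<close> that is maximal with \<open>x \<notin> K\<close> is simple: if \<open>B\<close> were the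
  direct sum of two nonzero members \<open>L\<close>, \<open>L'\<close>, then \<open>x\<close> would lie in both \<open>K + L\<close> and \<open>K + L'\<close>,
  whose intersection is \<open>K\<close>.\<close>

lemma simple_below:
  assumes N: "N \<in> \<S>" and x: "x \<in> N" "x \<noteq> 0"
  shows "\<exists>S. simple S \<and> S \<subseteq> N"
proof -
  let ?A = "{K \<in> \<S>. K \<subseteq> N \<and> x \<notin> K}"
  have "{0} \<in> ?A" using zero x additive_subgroupD(1)[OF subgroup[OF N]] by auto
  then have "?A \<noteq> {}" by blast
  then have "\<exists>K\<in>?A. \<forall>X\<in>?A. K \<subseteq> X \<longrightarrow> X = K"
  proof (rule subset_Zorn_nonempty)
    fix C assume C: "C \<noteq> {}" "subset.chain ?A C"
    then have "subset.chain \<S> C" by (auto simp: subset.chain_def)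
    then show "\<Union>C \<in> ?A" using chain_Union[OF C(1)] C by (auto simp: subset.chain_def)
  qed
  then obtain K where K: "K \<in> \<S>" "K \<subseteq> N" "x \<notin> K"
    and max: "\<And>X. X \<in> \<S> \<Longrightarrow> X \<subseteq> N \<Longrightarrow> x \<notin> X \<Longrightarrow> K \<subseteq> X \<Longrightarrow> X = K" by auto
  obtain B where B: "B \<in> \<S>" "B \<subseteq> N" "K \<inter> B = {0}" "N = {a + b | a b. a \<in> K \<and> b \<in> B}"
    using relative_complement[OF K(1) N K(2)] by blast
  note K0 = additive_subgroupD[OF subgroup[OF K(1)]]
  note B0 = additive_subgroupD[OF subgroup[OF B(1)]]
  note N0 = additive_subgroupD[OF subgroup[OF N]]
  have xin: "\<exists>k\<in>K. \<exists>l\<in>L. x = k + l" if L: "L \<in> \<S>" "L \<subseteq> B" "L \<noteq> {0}" for L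
  proof (rule ccontr)
    assume none: "\<not> ?thesis"
    note L0 = additive_subgroupD[OF subgroup[OF L(1)]]
    let ?X = "{a + b | a b. a \<in> K \<and> b \<in> L}"
    have "?X \<subseteq> N" using K(2) L(2) B(2) N0(4) by blast
    moreover have "K \<subseteq> ?X" using L0(1) by force
    ultimately have "?X = K" using max[OF add[OF K(1) L(1)]] none by blast
    moreover have "L \<subseteq> ?X" using K0(1) by force
    ultimately have "L \<subseteq> K \<inter> B" using L(2) by blast
    then show False using B(3) L0(1) L(3) by blast
  qed
  have "simple B"
    unfolding simple_def
  proof (intro conjI ballI impI)
    show "B \<in> \<S>" by fact
    obtain k b where kb: "k \<in> K" "b \<in> B" "x = k + b" using B(4) x(1) by blast
    then have "b \<noteq> 0" using K(3) by auto
    then show "B \<noteq> {0}" using kb(2) by blast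
    fix L assume L: "L \<in> \<S>" "L \<subseteq> B"
    obtain L' where L': "L' \<in> \<S>" "L' \<subseteq> B" "L \<inter> L' = {0}" "B = {a + b | a b. a \<in> L \<and> b \<in> L'}"
      using relative_complement[OF L(1) B(1) L(2)] by blast
    show "L = {0} \<or> L = B"
    proof (rule ccontr)
      assume neg: "\<not> ?thesis"
      have "L' \<noteq> {0}"
      proof
        assume "L' = {0}"
        then have "B \<subseteq> L" by (subst L'(4)) auto
        then show False using L(2) neg by blast
      qed
      from xin[OF L'(1,2) this] obtain k' l' where kl': "k' \<in> K" "l' \<in> L'" "x = k' + l'" by blast
      from neg have "L \<noteq> {0}" by blast
      from xin[OF L this] obtain k l where kl: "k \<in> K" "l \<in> L" "x = k + l" by blast
      have eq: "k - k' = l' - l" using kl(3) kl'(3) by (simp add: algebra_simps)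
      have "k - k' \<in> K" using kl(1) kl'(1) by (rule K0(2))
      moreover have "k - k' \<in> B"
        unfolding eq by (rule B0(2)) (use kl(2) kl'(2) L(2) L'(2) in auto)
      ultimately have "k - k' \<in> K \<inter> B" by (rule IntI)
      then have "k - k' = 0" unfolding B(3) by (rule singletonD)
      then have "l = l'" using eq by simp
      then have "l \<in> L \<inter> L'" using kl(2) kl'(2) by (intro IntI) simp_all
      then have "l = 0" unfolding L'(3) by (rule singletonD)
      then show False using kl K(3) by simp
    qed
  qed
  with B(2) show ?thesis by (intro exI[of _ B] conjI)
qed

text \<open>Only binary sums and directed unions are assumed to stay in the family; an arbitrary sum is the
  directed union of the finite ones.\<close>

lemma family_sum_mem:
  assumes F: "F \<subseteq> \<S>"
  shows "family_sum F \<in> \<S>"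
proof -
  have fin: "family_sum G \<in> \<S>" if "finite G" "G \<subseteq> \<S>" for G
    using that
  proof (induction G)
    case empty
    have "direct_sum_carrier {} = {(\<lambda>_. 0) :: 'a set \<Rightarrow> 'a}"
      by (auto simp: direct_sum_carrier_def)
    then show ?case using zero by (simp add: family_sum_def support_sum_def)
  next
    case (insert S G)
    then show ?case using add[of S "family_sum G"] subgroup by (subst family_sum_insert) auto
  qed
  have mono: "family_sum G \<subseteq> family_sum G'" if "G \<subseteq> G'" "G' \<subseteq> \<S>" for G G'
    unfolding family_sum_def
  proof (intro image_mono subsetI)
    fix f assume f: "f \<in> direct_sum_carrier G"
    have "\<forall>N\<in>G'. 0 \<in> N" using that(2) additive_subgroupD(1)[OF subgroup] by blast
    with f that(1) show "f \<in> direct_sum_carrier G'" by (rule direct_sum_carrier_mono)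
  qed
  let ?D = "family_sum ` {G. finite G \<and> G \<subseteq> F}"
  have "\<Union>?D \<in> \<S>"
  proof (rule directed_Union)
    show "?D \<subseteq> \<S>" using fin F by auto
    show "?D \<noteq> {}" by blast
    fix A B assume "A \<in> ?D" "B \<in> ?D"
    then obtain G G' where "A = family_sum G" "finite G" "G \<subseteq> F" "B = family_sum G'" "finite G'" "G' \<subseteq> F"
      by blast
    then show "\<exists>C\<in>?D. A \<union> B \<subseteq> C"
      using mono[of G "G \<union> G'"] mono[of G' "G \<union> G'"] F
      by (intro bexI[of _ "family_sum (G \<union> G')"]) auto
  qed
  moreover have "family_sum F = \<Union>?D"
  proof
    show "\<Union>?D \<subseteq> family_sum F" using mono F by blast
    show "family_sum F \<subseteq> \<Union>?D"
    proof
      fix x assume "x \<in> family_sum F"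
      then obtain f where f: "f \<in> direct_sum_carrier F" "x = support_sum f" by (auto simp: family_sum_def)
      let ?G = "{N. f N \<noteq> 0}"
      have G: "finite ?G" "?G \<subseteq> F" using f by (auto simp: direct_sum_carrier_def)
      then have "f \<in> direct_sum_carrier ?G"
        by (intro direct_sum_carrier_restrict[OF f(1)]) auto
      then show "x \<in> \<Union>?D" using G f(2) unfolding family_sum_def by blast
    qed
  qed
  ultimately show ?thesis by simp
qed

lemma family_sum_upper:
  assumes "F \<subseteq> \<S>" "S \<in> F"
  shows "S \<subseteq> family_sum F"
proof
  fix a assume "a \<in> S"
  then have "(\<lambda>N. if N = S then a else 0) \<in> direct_sum_carrier F"
    using assms subgroup by (intro direct_sum_carrier_single) auto
  then show "a \<in> family_sum F" unfolding family_sum_def by (metis imageI support_sum_single)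
qed

text \<open>A relation involving \<open>S\<close> would express an element of \<open>S\<close> through the other members.\<close>

lemma independent_insert:
  assumes F: "F \<subseteq> \<S>" "independent_family F" and S: "S \<in> \<S>" and disj: "S \<inter> family_sum F = {0}"
  shows "independent_family (insert S F)"
proof (cases "S \<in> F")
  case True
  then show ?thesis using F by (simp add: insert_absorb)
next
  case False
  show ?thesis unfolding independent_family_def
  proof (intro ballI impI)
    fix f assume f: "f \<in> direct_sum_carrier (insert S F)" "support_sum f = 0"
    have split: "0 = f S + support_sum (f(S := 0))" and fS: "f S \<in> S"
      using support_sum_split[of f S] f by (auto simp: direct_sum_carrier_def)
    have f': "f(S := 0) \<in> direct_sum_carrier F"
      using direct_sum_carrier_delete[OF f(1)] F subgroup False by blast
    have "support_sum (f(S := 0)) \<in> S"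
      using split additive_subgroupD(3)[OF subgroup[OF S] fS] by (metis add.inverse_inverse add.inverse_unique)
    then have "support_sum (f(S := 0)) = 0" using f' disj unfolding family_sum_def by blast
    then have "f S = 0" "f(S := 0) = (\<lambda>_. 0)"
      using split F(2) f' by (auto simp: independent_family_def)
    then show "f = (\<lambda>_. 0)" by (metis fun_upd_triv)
  qed
qed

text \<open>A complement of the sum of a maximal independent family of simple members must vanish, since
  otherwise it would contain a further simple member.\<close>

lemma direct_sum_of_simples:
  "\<exists>F. (\<forall>N\<in>F. simple N) \<and> internal_direct_sum F V"
proof -
  let ?A = "{F. (\<forall>N\<in>F. simple N) \<and> independent_family F}"
  have "\<exists>F\<in>?A. \<forall>X\<in>?A. F \<subseteq> X \<longrightarrow> X = F"
  proof (rule subset_Zorn_nonempty)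
    have "{} \<in> ?A" by (auto simp: independent_family_def direct_sum_carrier_def)
    then show "?A \<noteq> {}" by blast
    fix C assume C: "C \<noteq> {}" "subset.chain ?A C"
    have "f = (\<lambda>_. 0)" if f: "f \<in> direct_sum_carrier (\<Union>C)" "support_sum f = 0" for f
    proof -
      have "finite {N. f N \<noteq> 0}" "{N. f N \<noteq> 0} \<subseteq> \<Union>C"
        using f by (auto simp: direct_sum_carrier_def)
      then obtain G where G: "G \<in> C" "{N. f N \<noteq> 0} \<subseteq> G"
        using finite_subset_Union_chain[OF _ _ C] by blast
      have GA: "G \<in> ?A" using G C by (auto simp: subset.chain_def)
      then have "f \<in> direct_sum_carrier G"
        using G by (intro direct_sum_carrier_restrict[OF f(1)]) auto
      then show ?thesis using GA f(2) by (auto simp: independent_family_def)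
    qed
    then show "\<Union>C \<in> ?A"
      using C by (auto simp: independent_family_def subset.chain_def)
  qed
  then obtain F where F: "\<forall>N\<in>F. simple N" "independent_family F"
    and max: "\<And>X. \<forall>N\<in>X. simple N \<Longrightarrow> independent_family X \<Longrightarrow> F \<subseteq> X \<Longrightarrow> X = F" by auto
  have FS: "F \<subseteq> \<S>" using F by (auto simp: simple_def)
  have T: "family_sum F \<in> \<S>" by (rule family_sum_mem[OF FS])
  obtain B where B: "B \<in> \<S>" "family_sum F \<inter> B = {0}" "V = {a + b | a b. a \<in> family_sum F \<and> b \<in> B}"
    using complement[OF T] by blast
  have "B = {0}"
  proof (rule ccontr)
    assume "B \<noteq> {0}"
    then obtain x where "x \<in> B" "x \<noteq> 0" using additive_subgroupD(1)[OF subgroup[OF B(1)]] by blast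
    then obtain S where S: "simple S" "S \<subseteq> B" using simple_below[OF B(1)] by blast
    have SS: "S \<in> \<S>" using S by (simp add: simple_def)
    have disj: "S \<inter> family_sum F = {0}"
      using S B(2) additive_subgroupD(1)[OF subgroup[OF SS]] additive_subgroupD(1)[OF subgroup[OF T]] by blast
    have "insert S F = F"
      using max[of "insert S F"] independent_insert[OF FS F(2) SS disj] F(1) S(1) by blast
    then have "S \<subseteq> family_sum F" using family_sum_upper[OF FS] by blast
    then show False using disj S(1) by (auto simp: simple_def)
  qed
  then have "V = family_sum F" unfolding B(3) by auto
  then have "family_sum F = V" by simp
  moreover have "\<forall>N\<in>F. additive_subgroup N" using FS subgroup by blast
  ultimately have "internal_direct_sum F V" using internal_direct_sumI F(2) by blast
  with F(1) show ?thesis by (intro exI[of _ F] conjI)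
qed

end

lemma internal_direct_sumD:
  assumes "internal_direct_sum F V" "\<forall>N\<in>F. additive_subgroup N"
  shows "x \<in> V \<Longrightarrow> \<exists>f\<in>direct_sum_carrier F. x = support_sum f"
    "f \<in> direct_sum_carrier F \<Longrightarrow> g \<in> direct_sum_carrier F \<Longrightarrow> support_sum f = support_sum g \<Longrightarrow> f = g"
  using assms(1) unfolding internal_direct_sum_def bij_betw_def support_sum_def[symmetric, abs_def] inj_on_def
  by (auto simp: support_sum_def)

text \<open>The coordinates of a vector with respect to a direct sum are unique, hence depend linearly on it.\<close>

lemma exists_component_projection:
  assumes s: "vector_space s" and sub: "\<forall>N\<in>F. module.subspace s N" and F: "internal_direct_sum F UNIV"
    and C: "C \<in> F"
  shows "\<exists>p. lin s s p \<and> (\<forall>x. p x \<in> C) \<and> (\<forall>f\<in>direct_sum_carrier F. p (support_sum f) = f C)"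
proof -
  have grp: "\<forall>N\<in>F. additive_subgroup N"
    using subspaceD(1,4)[OF s] sub by (simp add: additive_subgroup_def)
  note D = internal_direct_sumD[OF F grp]
  have "\<forall>x. \<exists>f. f \<in> direct_sum_carrier F \<and> x = support_sum f" using D(1) by blast
  then obtain c where c: "\<And>x. c x \<in> direct_sum_carrier F" "\<And>x. x = support_sum (c x)"
    by metis
  have cs: "c (support_sum f) = f" if "f \<in> direct_sum_carrier F" for f
    using D(2)[OF c(1) that] c(2) by metis
  have fin: "finite {N. c x N \<noteq> 0}" for x using c(1) by (simp add: direct_sum_carrier_def)
  have "lin s s (\<lambda>x. c x C)"
    unfolding Vector_Spaces.linear_iff
  proof (intro conjI allI)
    fix x y k
    have "support_sum (\<lambda>N. c x N + c y N) = x + y"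
      by (subst support_sum_add[OF fin fin]) (simp flip: c(2))
    then have "c (x + y) = (\<lambda>N. c x N + c y N)"
      using cs[OF direct_sum_carrier_add[OF grp c(1)[of x] c(1)[of y]]] by simp
    then show "c (x + y) C = c x C + c y C" by simp
    have sub0: "{N. s k (c x N) \<noteq> 0} \<subseteq> {N. c x N \<noteq> 0}"
      using vector_spaceD(6)[OF s] by (intro Collect_mono) metis
    have "finite {N. s k (c x N) \<noteq> 0}" by (rule finite_subset[OF sub0 fin])
    then have mem: "(\<lambda>N. s k (c x N)) \<in> direct_sum_carrier F"
      using c(1)[of x] subspaceD(3)[OF s] sub by (simp add: direct_sum_carrier_def vector_spaceD(6)[OF s])
    have "support_sum (\<lambda>N. s k (c x N)) = s k (support_sum (c x))"
      by (subst support_sum_eq_sum[OF fin sub0]) (simp add: support_sum_def vector_spaceD(8)[OF s])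
    then have "c (s k x) = (\<lambda>N. s k (c x N))" using cs[OF mem] by (simp flip: c(2))
    then show "c (s k x) C = s k (c x C)" by simp
  qed (fact s)+
  moreover have "c x C \<in> C" for x using c(1) C by (simp add: direct_sum_carrier_def)
  ultimately show ?thesis using cs by (intro exI[of _ "\<lambda>x. c x C"]) simp
qed

section \<open>Calculus of the comultiplication\<close>

locale hopf_calculus =
  fixes H :: "('k::field, 'h::ring_1) hopf"
  assumes hopf: "hopf_algebra H"
begin

abbreviation "sH \<equiv> hscale H"
abbreviation "\<epsilon> \<equiv> counit H"
abbreviation "S \<equiv> antipode H"

definition sw :: "('k \<Rightarrow> 'v::ab_group_add \<Rightarrow> 'v) \<Rightarrow> ('h \<Rightarrow> 'h \<Rightarrow> 'v) \<Rightarrow> 'h \<Rightarrow> 'v" where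
  "sw s \<beta> h = lin_extend s (\<lambda>(a, b). \<beta> a b) (sweedlerH H h)"

lemma bialg: "bialgebra H" using hopf by (simp add: hopf_algebra_def)
lemma alg: "k_algebra H" using bialg by (simp add: bialgebra_def)
lemma coalg: "coalgebra H" using bialg by (simp add: bialgebra_def)

lemma vector_space_H [linear_intros]: "vector_space sH" using alg by (simp add: k_algebra_def)

lemmas sH = vector_spaceD[OF vector_space_H]

lemma scale_mult: "sH c x * y = sH c (x * y)" "x * sH c y = sH c (x * y)"
proof -
  have "sH c (x * y) = sH c x * y" "sH c (x * y) = x * sH c y" using alg unfolding k_algebra_def by blast+
  then show "sH c x * y = sH c (x * y)" "x * sH c y = sH c (x * y)" by simp_all
qed

lemma linear_mult:
  assumes "lin s sH f"
  shows "lin s sH (\<lambda>x. f x * c)" "lin s sH (\<lambda>x. c * f x)"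
  using assms by (simp_all add: Vector_Spaces.linear_iff algebra_simps scale_mult)

lemma linear_counit: "lin sH (*) \<epsilon>"
  using coalg by (simp add: Vector_Spaces.linear_iff vector_space_H vector_space_mult coalgebra_def)

lemma linear_antipode: "lin sH sH S"
  using hopf by (simp add: Vector_Spaces.linear_iff vector_space_H hopf_algebra_def)

lemmas [linear_intros] = linear_mult linear_comp[OF linear_counit] linear_comp[OF linear_antipode] vector_space_mult

lemma counit_mult: "\<epsilon> (g * h) = \<epsilon> g * \<epsilon> h" and counit_one: "\<epsilon> 1 = 1"
  using bialg by (simp_all add: bialgebra_def)

lemma tensor2_sweedlerH: "tensor2 sH sH (sweedlerH H h) = comult H h"
proof -
  have "comult H h \<in> tensor_of sH sH UNIV UNIV" using coalg by (simp add: coalgebra_def)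
  from sweedler_in_tensor_of(1)[OF this] show ?thesis by simp
qed

lemma sw_eqI:
  assumes "bilin sH sH s \<beta>" "comult H h = tensor2 sH sH x"
  shows "sw s \<beta> h = lin_extend s (\<lambda>(a, b). \<beta> a b) x"
  unfolding sw_def using trans[OF tensor2_sweedlerH assms(2)] by (rule lin_extend_tensor2[OF assms(1)])

lemma linear_sw:
  assumes "bilin sH sH s \<beta>"
  shows "lin sH s (sw s \<beta>)"
  unfolding Vector_Spaces.linear_iff
proof (intro conjI allI)
  note l = linD[OF linear_lin_extend[OF bilinD(1)[OF assms]]]
  fix g h c
  have "comult H (g + h) = tensor2 sH sH (sweedlerH H g + sweedlerH H h)"
    using coalg by (simp add: coalgebra_def)
  from sw_eqI[OF assms this] show "sw s \<beta> (g + h) = sw s \<beta> g + sw s \<beta> h"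
    by (simp add: sw_def l(3))
  have "comult H (sH c h) = tensor2 sH sH (fscale c (sweedlerH H h))"
    using coalg by (simp add: coalgebra_def)
  from sw_eqI[OF assms this] show "sw s \<beta> (sH c h) = s c (sw s \<beta> h)"
    by (simp add: sw_def l(4))
qed (fact vector_space_H bilinD(1)[OF assms])+

lemma linear_sw_arg [linear_intros]:
  "lin s1 sH f \<Longrightarrow> bilin sH sH s \<beta> \<Longrightarrow> lin s1 s (\<lambda>x. sw s \<beta> (f x))"
  by (rule linear_comp[OF linear_sw])

lemma linear_sw_param:
  assumes "vector_space s1" "vector_space s" "\<And>a b. lin s1 s (\<lambda>x. \<beta> x a b)"
  shows "lin s1 s (\<lambda>x. sw s (\<beta> x) h)"
  unfolding sw_def by (rule linear_lin_extend_param) (use assms in \<open>simp_all add: case_prod_unfold\<close>)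

lemmas [linear_intros] = linear_sw_param bilinI trilinI

lemma sw_comp:
  assumes "lin s s' L"
  shows "L (sw s \<beta> h) = sw s' (\<lambda>a b. L (\<beta> a b)) h"
  unfolding sw_def by (rule lin_extend_comp2[OF assms])

lemma sw_swap:
  assumes "vector_space s"
  shows "sw s (\<lambda>a b. sw s (\<lambda>c d. \<beta> a b c d) h) g = sw s (\<lambda>c d. sw s (\<lambda>a b. \<beta> a b c d) g) h"
  unfolding sw_def by (rule lin_extend_swap2[OF assms])

lemma sw_mult:
  assumes "bilin sH sH s \<beta>"
  shows "sw s \<beta> (g * h) = sw s (\<lambda>a b. sw s (\<lambda>c d. \<beta> (a * c) (b * d)) h) g"
proof -
  note v = bilinD(1)[OF assms]
  have "comult H (g * h) = tensor2 sH sH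
        (lin_extend fscale (\<lambda>(a, b). lin_extend fscale (\<lambda>(c, d). Poly_Mapping.single (a * c, b * d) 1)
           (sweedlerH H h)) (sweedlerH H g))"
    using bialg by (simp add: bialgebra_def)
  from sw_eqI[OF assms this] show ?thesis
    unfolding lin_extend_comp2[OF linear_lin_extend[OF v]] lin_extend_single[OF v]
    by (simp add: sw_def vector_spaceD(4)[OF v])
qed

lemma sw_one:
  assumes "bilin sH sH s \<beta>"
  shows "sw s \<beta> 1 = \<beta> 1 1"
proof -
  have "comult H 1 = tensor2 sH sH (Poly_Mapping.single (1, 1) 1)"
    using bialg by (simp add: bialgebra_def)
  from sw_eqI[OF assms this] show ?thesis
    by (simp add: lin_extend_single[OF bilinD(1)[OF assms]] vector_spaceD(4)[OF bilinD(1)[OF assms]])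
qed

lemma sw_coassoc:
  assumes "trilin sH sH sH s \<tau>"
  shows "sw s (\<lambda>a b. sw s (\<lambda>a1 a2. \<tau> a1 a2 b) a) h = sw s (\<lambda>a b. sw s (\<lambda>b1 b2. \<tau> a b1 b2) b) h"
proof -
  have v: "vector_space s" using assms unfolding trilin_def by (blast dest: linD(2))
  have "tensor3 sH sH sH
            (lin_extend fscale (\<lambda>(a, b). lin_extend fscale (\<lambda>(a1, a2). Poly_Mapping.single (a1, a2, b) 1)
               (sweedlerH H a)) (sweedlerH H h)) =
          tensor3 sH sH sH
            (lin_extend fscale (\<lambda>(a, b). lin_extend fscale (\<lambda>(b1, b2). Poly_Mapping.single (a, b1, b2) 1)
               (sweedlerH H b)) (sweedlerH H h))"
    using coalg by (simp add: coalgebra_def)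
  from lin_extend_tensor3[OF assms this] show ?thesis
    unfolding lin_extend_comp2[OF linear_lin_extend[OF v]] lin_extend_single[OF v]
    by (simp add: sw_def vector_spaceD(4)[OF v])
qed

lemma sw_counit:
  assumes "lin sH s L"
  shows "sw s (\<lambda>a b. s (\<epsilon> a) (L b)) h = L h" "sw s (\<lambda>a b. s (\<epsilon> b) (L a)) h = L h"
proof -
  have e: "sw sH (\<lambda>a b. sH (\<epsilon> a) b) h = h" "sw sH (\<lambda>a b. sH (\<epsilon> b) a) h = h"
    using coalg by (simp_all add: coalgebra_def sw_def)
  from arg_cong[OF e(1), of L] show "sw s (\<lambda>a b. s (\<epsilon> a) (L b)) h = L h"
    by (simp add: sw_comp[OF assms] linD(4)[OF assms])
  from arg_cong[OF e(2), of L] show "sw s (\<lambda>a b. s (\<epsilon> b) (L a)) h = L h"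
    by (simp add: sw_comp[OF assms] linD(4)[OF assms])
qed

lemma sw_antipode:
  assumes "lin sH s L"
  shows "sw s (\<lambda>a b. L (S a * b)) h = s (\<epsilon> h) (L 1)" "sw s (\<lambda>a b. L (a * S b)) h = s (\<epsilon> h) (L 1)"
proof -
  have e: "sw sH (\<lambda>a b. S a * b) h = sH (\<epsilon> h) 1" "sw sH (\<lambda>a b. a * S b) h = sH (\<epsilon> h) 1"
    using hopf by (simp_all add: hopf_algebra_def sw_def)
  from arg_cong[OF e(1), of L] show "sw s (\<lambda>a b. L (S a * b)) h = s (\<epsilon> h) (L 1)"
    by (simp add: sw_comp[OF assms] linD(4)[OF assms])
  from arg_cong[OF e(2), of L] show "sw s (\<lambda>a b. L (a * S b)) h = s (\<epsilon> h) (L 1)"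
    by (simp add: sw_comp[OF assms] linD(4)[OF assms])
qed

section \<open>Integrals\<close>

text \<open>In Sweedler notation: \<open>\<Delta>(S(h\<^sub>1)) (h\<^sub>2 \<otimes> 1) = 1 \<otimes> S(h)\<close>. Insert
  \<open>h\<^sub>3 S(h\<^sub>4)\<close> in the second factor and use \<open>\<Delta>(S(h\<^sub>1)) \<Delta>(h\<^sub>2) = \<Delta>(S(h\<^sub>1) h\<^sub>2) = \<epsilon>(h) (1 \<otimes> 1)\<close>.\<close>

lemma sw_antipode_cancel:
  assumes \<beta>: "bilin sH sH s \<beta>"
  shows "sw s (\<lambda>a b. sw s (\<lambda>u v. \<beta> (u * b) v) (S a)) h = \<beta> 1 (S h)"
proof -
  note v = bilinD(1)[OF \<beta>]
  note [linear_intros] = v bilinD(4,5)[OF \<beta>]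
  have inner: "sw s (\<lambda>c b. sw s (\<lambda>u v. \<beta> u (v * S b)) (S a * c)) w = sw s (\<lambda>u v. \<beta> (u * w) v) (S a)" for a w
  proof -
    have "sw s (\<lambda>c b. sw s (\<lambda>u v. \<beta> u (v * S b)) (S a * c)) w =
        sw s (\<lambda>c b. sw s (\<lambda>u v. sw s (\<lambda>c1 c2. \<beta> (u * c1) (v * (c2 * S b))) c) (S a)) w"
      by (subst sw_mult) (intro linear_intros, simp add: mult.assoc)
    also have "\<dots> = sw s (\<lambda>u v. sw s (\<lambda>c b. sw s (\<lambda>c1 c2. \<beta> (u * c1) (v * (c2 * S b))) c) w) (S a)"
      by (rule sw_swap[OF v])
    also have "\<dots> = sw s (\<lambda>u v. sw s (\<lambda>c e. sw s (\<lambda>d b. \<beta> (u * c) (v * (d * S b))) e) w) (S a)"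
      by (subst sw_coassoc) (intro linear_intros, rule refl)
    also have "\<dots> = sw s (\<lambda>u v. sw s (\<lambda>c e. s (\<epsilon> e) (\<beta> (u * c) (v * 1))) w) (S a)"
      by (subst sw_antipode(2)) (intro linear_intros, rule refl)
    also have "\<dots> = sw s (\<lambda>u v. \<beta> (u * w) v) (S a)"
      by (subst sw_counit(2)) (intro linear_intros, simp)
    finally show ?thesis .
  qed
  have "\<beta> 1 (S h) = sw s (\<lambda>a b. s (\<epsilon> a) (\<beta> 1 (S b))) h"
    by (subst sw_counit(1)) (intro linear_intros, rule refl)
  also have "\<dots> = sw s (\<lambda>a b. sw s (\<lambda>c d. sw s (\<lambda>u v. \<beta> u (v * S b)) (S c * d)) a) h"
    by (subst sw_antipode(1), intro linear_intros, subst sw_one, intro linear_intros, simp)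
  also have "\<dots> = sw s (\<lambda>a w. sw s (\<lambda>c b. sw s (\<lambda>u v. \<beta> u (v * S b)) (S a * c)) w) h"
    by (subst sw_coassoc) (intro linear_intros, rule refl)
  finally show ?thesis by (simp add: inner)
qed

text \<open>In Sweedler notation: \<open>S(h\<^sub>1 g) h\<^sub>2 = \<epsilon>(h) S(g)\<close>. Insert \<open>g\<^sub>2 S(g\<^sub>3)\<close>
  on the right and use \<open>S(h\<^sub>1 g\<^sub>1) h\<^sub>2 g\<^sub>2 = \<epsilon>(h g)\<close>.\<close>

lemma sw_antipode_absorb:
  assumes L: "lin sH s L"
  shows "sw s (\<lambda>a b. L (S (a * g) * b)) h = s (\<epsilon> h) (L (S g))"
proof -
  note v = linD(2)[OF L]
  note [linear_intros] = v linear_comp[OF L]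
  have "s (\<epsilon> h) (L (S g)) = s (\<epsilon> h) (sw s (\<lambda>a b. s (\<epsilon> a) (L (S b))) g)"
    by (subst sw_counit(1)) (intro linear_intros, rule refl)
  also have "\<dots> = sw s (\<lambda>a b. s (\<epsilon> h) (s (\<epsilon> a) (L (S b)))) g"
    by (rule sw_comp) (intro linear_intros)
  also have "\<dots> = sw s (\<lambda>a b. s (\<epsilon> (h * a)) (L (1 * S b))) g"
    by (simp add: vector_spaceD(3)[OF v] counit_mult)
  also have "\<dots> = sw s (\<lambda>a b. sw s (\<lambda>x y. L (S x * y * S b)) (h * a)) g"
    by (subst sw_antipode(1)) (intro linear_intros, rule refl)
  also have "\<dots> = sw s (\<lambda>a b. sw s (\<lambda>p q. sw s (\<lambda>c d. L (S (p * c) * (q * (d * S b)))) a) h) g"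
    by (subst sw_mult) (intro linear_intros, simp add: mult.assoc)
  also have "\<dots> = sw s (\<lambda>p q. sw s (\<lambda>a b. sw s (\<lambda>c d. L (S (p * c) * (q * (d * S b)))) a) g) h"
    by (rule sw_swap[OF v])
  also have "\<dots> = sw s (\<lambda>p q. sw s (\<lambda>c e. sw s (\<lambda>d b. L (S (p * c) * (q * (d * S b)))) e) g) h"
    by (subst sw_coassoc) (intro linear_intros, rule refl)
  also have "\<dots> = sw s (\<lambda>p q. sw s (\<lambda>c e. s (\<epsilon> e) (L (S (p * c) * (q * 1)))) g) h"
    by (subst sw_antipode(2)) (intro linear_intros, rule refl)
  also have "\<dots> = sw s (\<lambda>p q. L (S (p * g) * q)) h"
    by (subst sw_counit(2)) (intro linear_intros, simp)
  finally show ?thesis by simp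
qed

text \<open>In Sweedler notation: \<open>h t\<^sub>1 \<otimes> S(t\<^sub>2) = t\<^sub>1 \<otimes> S(t\<^sub>2) h\<close>. This makes averages over \<open>t\<close>
  linear over \<open>H\<close>. On the right, replace \<open>\<epsilon>(h\<^sub>1) t\<close> by \<open>h\<^sub>1 t\<close> and absorb the antipode by the
  preceding lemma.\<close>

lemma integral_slide:
  assumes t: "\<And>h. h * t = sH (\<epsilon> h) t" and \<gamma>: "bilin sH sH s \<gamma>"
  shows "sw s (\<lambda>a b. \<gamma> (h * a) (S b)) t = sw s (\<lambda>a b. \<gamma> a (S b * h)) t"
proof -
  note v = bilinD(1)[OF \<gamma>]
  note [linear_intros] = v bilinD(4,5)[OF \<gamma>]
  have inner: "sw s (\<lambda>c b. sw s (\<lambda>p q. \<gamma> (a * p) (S (c * q) * b)) t) w = s (\<epsilon> w) (sw s (\<lambda>p q. \<gamma> (a * p) (S q)) t)" for a w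
  proof -
    have "sw s (\<lambda>c b. sw s (\<lambda>p q. \<gamma> (a * p) (S (c * q) * b)) t) w =
        sw s (\<lambda>p q. sw s (\<lambda>c b. \<gamma> (a * p) (S (c * q) * b)) w) t"
      by (rule sw_swap[OF v])
    also have "\<dots> = sw s (\<lambda>p q. s (\<epsilon> w) (\<gamma> (a * p) (S q))) t"
      by (subst sw_antipode_absorb) (intro linear_intros, rule refl)
    also have "\<dots> = s (\<epsilon> w) (sw s (\<lambda>p q. \<gamma> (a * p) (S q)) t)"
      by (rule sw_comp[symmetric]) (intro linear_intros)
    finally show ?thesis .
  qed
  have "sw s (\<lambda>a b. \<gamma> a (S b * h)) t = sw s (\<lambda>a b. s (\<epsilon> a) (sw s (\<lambda>p q. \<gamma> p (S q * b)) t)) h"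
    by (subst sw_counit(1)) (intro linear_intros, rule refl)
  also have "\<dots> = sw s (\<lambda>a b. sw s (\<lambda>p q. \<gamma> p (S q * b)) (a * t)) h"
  proof -
    have "lin sH s (sw s (\<lambda>p q. \<gamma> p (S q * b)))" for b by (rule linear_sw) (intro linear_intros)
    from linD(4)[OF this] show ?thesis by (simp add: t)
  qed
  also have "\<dots> = sw s (\<lambda>a b. sw s (\<lambda>c d. sw s (\<lambda>p q. \<gamma> (c * p) (S (d * q) * b)) t) a) h"
    by (subst sw_mult) (intro linear_intros, rule refl)
  also have "\<dots> = sw s (\<lambda>a w. sw s (\<lambda>c b. sw s (\<lambda>p q. \<gamma> (a * p) (S (c * q) * b)) t) w) h"
    by (subst sw_coassoc) (intro linear_intros, rule refl)
  also have "\<dots> = sw s (\<lambda>p q. \<gamma> (h * p) (S q)) t"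
    unfolding inner by (subst sw_counit(2)) (intro linear_intros, rule refl)
  finally show ?thesis by simp
qed

text \<open>A normalised integral in the dual of \<open>H\<close>.\<close>

definition cointegral :: "('h \<Rightarrow> 'k) \<Rightarrow> bool" where
  "cointegral l \<longleftrightarrow> lin sH (*) l \<and> l 1 = 1 \<and> (\<forall>h. sw sH (\<lambda>a b. sH (l b) a) h = sH (l h) 1)"

text \<open>In Sweedler notation: \<open>\<Sum> l(g\<^sub>2 S(h)) g\<^sub>1 = \<Sum> l(g S(h\<^sub>1)) h\<^sub>2\<close>, under any linear map \<open>L\<close>.
  This makes averages over \<open>l\<close> colinear. Apply the defining property of \<open>l\<close> to \<open>g S(h\<^sub>1)\<close>, multiply
  by \<open>h\<^sub>2\<close> and cancel by \<open>sw_antipode_cancel\<close>.\<close>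

lemma cointegral_slide:
  assumes l: "cointegral l" and L: "lin sH s L"
  shows "sw s (\<lambda>a b. s (l (b * S h)) (L a)) g = sw s (\<lambda>a b. s (l (g * S a)) (L b)) h"
proof -
  have l': "lin sH (*) l" using l by (simp add: cointegral_def)
  note v = linD(2)[OF L]
  note [linear_intros] = v linear_comp[OF L] linear_comp[OF l']
  have int: "sw s (\<lambda>a b. s (l b) (M a)) x = s (l x) (M 1)" if M: "lin sH s M" for M x
  proof -
    have "sw sH (\<lambda>a b. sH (l b) a) x = sH (l x) 1" using l by (simp add: cointegral_def)
    from arg_cong[OF this, of M] show ?thesis by (simp add: sw_comp[OF M] linD(4)[OF M])
  qed
  have "sw s (\<lambda>a b. s (l (g * S a)) (L b)) h = sw s (\<lambda>a b. s (l (g * S a)) (L (1 * b))) h" by simp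
  also have "\<dots> = sw s (\<lambda>a b. sw s (\<lambda>p q. s (l q) (L (p * b))) (g * S a)) h"
    by (subst int) (intro linear_intros, rule refl)
  also have "\<dots> = sw s (\<lambda>a b. sw s (\<lambda>p q. sw s (\<lambda>u v. s (l (q * v)) (L (p * (u * b)))) (S a)) g) h"
    by (subst sw_mult) (intro linear_intros, simp add: mult.assoc)
  also have "\<dots> = sw s (\<lambda>p q. sw s (\<lambda>a b. sw s (\<lambda>u v. s (l (q * v)) (L (p * (u * b)))) (S a)) h) g"
    by (rule sw_swap[OF v])
  also have "\<dots> = sw s (\<lambda>p q. s (l (q * S h)) (L (p * 1))) g"
    by (subst sw_antipode_cancel) (intro linear_intros, rule refl)
  finally show ?thesis by simp
qed

text \<open>The components of \<open>1\<close> in the simple left ideals cannot all lie in the kernel of the counit. On a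
  simple left ideal that is not contained in this kernel the counit is injective, and it takes the same
  value on \<open>h t\<close> and on \<open>\<epsilon>(h) t\<close>.\<close>

lemma exists_integral:
  assumes "semisimple_algebra TYPE('h)"
  shows "\<exists>t. (\<forall>h. h * t = sH (\<epsilon> h) t) \<and> \<epsilon> t = 1"
proof -
  obtain F :: "'h set set" where F: "\<forall>I\<in>F. simple_left_ideal I" "internal_direct_sum F UNIV"
    using assms by (auto simp: semisimple_algebra_def)
  have "1 \<in> (\<lambda>f. \<Sum>N | f N \<noteq> 0. f N) ` direct_sum_carrier F"
    using F(2) by (simp add: internal_direct_sum_def bij_betw_def)
  then obtain f where f: "f \<in> direct_sum_carrier F" "1 = (\<Sum>N | f N \<noteq> 0. f N)" by blast
  have "(\<Sum>N | f N \<noteq> 0. \<epsilon> (f N)) = 1"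
    using arg_cong[OF f(2), of \<epsilon>] by (simp add: linD(7)[OF linear_counit] counit_one)
  then obtain I where I: "f I \<noteq> 0" "\<epsilon> (f I) \<noteq> 0"
    by (metis (mono_tags, lifting) mem_Collect_eq sum.neutral zero_neq_one)
  have IF: "I \<in> F" "f I \<in> I" using f(1) I(1) unfolding direct_sum_carrier_def by blast+
  have ideal: "left_ideal I" and simple: "\<And>J. left_ideal J \<Longrightarrow> J \<subseteq> I \<Longrightarrow> J = {0} \<or> J = I"
    using F(1) IF(1) by (auto simp: simple_left_ideal_def)
  have add: "x + y \<in> I" if "x \<in> I" "y \<in> I" for x y using ideal that by (simp add: left_ideal_def)
  have mult: "h * x \<in> I" if "x \<in> I" for h x using ideal that by (simp add: left_ideal_def)
  have "left_ideal {x \<in> I. \<epsilon> x = 0}"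
    using ideal add mult by (simp add: left_ideal_def counit_mult linD(3,5)[OF linear_counit])
  then have "{x \<in> I. \<epsilon> x = 0} = {0} \<or> {x \<in> I. \<epsilon> x = 0} = I" by (rule simple) blast
  then have inj: "x = 0" if "x \<in> I" "\<epsilon> x = 0" for x using that I(2) IF(2) by blast
  have scaleI: "sH c x \<in> I" if "x \<in> I" for c x
    using mult[OF that, of "sH c 1"] by (simp add: scale_mult)
  (* f I is the component of 1 in I, rescaled here to counit 1 *)
  define t where "t = sH (1 / \<epsilon> (f I)) (f I)"
  have t: "t \<in> I" "\<epsilon> t = 1" using scaleI[OF IF(2)] I(2) by (simp_all add: t_def linD(4)[OF linear_counit])
  have "h * t = sH (\<epsilon> h) t" for h
  proof -
    have eq: "h * t - sH (\<epsilon> h) t = h * t + sH (- \<epsilon> h) t" using sH(9)[of 0 "\<epsilon> h" t] by (simp add: sH(5))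
    have "h * t - sH (\<epsilon> h) t \<in> I" unfolding eq by (intro add mult scaleI t(1))
    moreover have "\<epsilon> (h * t - sH (\<epsilon> h) t) = 0"
      by (simp add: linD(4,6)[OF linear_counit] counit_mult t(2))
    ultimately show ?thesis using inj by (metis eq_iff_diff_eq_0)
  qed
  then show ?thesis using t(2) by blast
qed

lemma sw_subcoalgebra:
  assumes "subcoalgebra H C" "h \<in> C" "bilin sH sH s \<beta>"
  shows "\<exists>x. Poly_Mapping.keys x \<subseteq> C \<times> C \<and> sw s \<beta> h = lin_extend s (\<lambda>(a, b). \<beta> a b) x"
proof -
  have "comult H h \<in> tensor_of sH sH C C" using assms by (simp add: subcoalgebra_def)
  then obtain x where "comult H h = tensor2 sH sH x" "Poly_Mapping.keys x \<subseteq> C \<times> C"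
    by (auto simp: tensor_of_def)
  then show ?thesis using sw_eqI[OF assms(3)] by blast
qed

lemma subcoalgebra_one: "subcoalgebra H {sH c 1 | c. True}"
proof -
  have "comult H (sH c 1) \<in> tensor_of sH sH {sH c 1 | c. True} {sH c 1 | c. True}" for c
  proof -
    let ?z = "Poly_Mapping.single (1, 1) 1"
    have "comult H 1 = tensor2 sH sH ?z" using bialg by (simp add: bialgebra_def)
    then have "sweedlerH H 1 - ?z \<in> relations2 sH sH"
      using tensor2_sweedlerH[of 1] by (simp flip: tensor2_eq_iff)
    then have "fscale c (sweedlerH H 1 - ?z) \<in> relations2 sH sH"
      by (rule subspaceD(3)[OF vector_space_fscale subspace_relations(1)])
    then have "tensor2 sH sH (fscale c (sweedlerH H 1)) = tensor2 sH sH (fscale c ?z)"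
      by (simp add: tensor2_eq_iff vector_spaceD(7)[OF vector_space_fscale])
    then have "comult H (sH c 1) = tensor2 sH sH (fscale c ?z)"
      using coalg by (simp add: coalgebra_def)
    moreover have "Poly_Mapping.keys (fscale c ?z) \<subseteq> {(1, 1)}"
      by (auto simp: in_keys_iff lookup_single when_def split: if_splits)
    moreover have "(1 :: 'h) \<in> {sH c 1 | c. True}" using sH(4)[of 1] by (metis (mono_tags) mem_Collect_eq)
    ultimately show ?thesis unfolding tensor_of_def by blast
  qed
  moreover have "module.subspace sH {sH c 1 | c. True}"
    unfolding subspace_iff[OF vector_space_H]
  proof (intro conjI ballI allI)
    show "0 \<in> {sH c 1 | c. True}" using sH(5)[of 1] by force
    fix x y c assume "x \<in> {sH c 1 | c. True}"
    then obtain a where a: "x = sH a 1" by blast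
    then have "sH c x = sH (c * a) 1" by (simp add: sH(3))
    then show "sH c x \<in> {sH c 1 | c. True}" by blast
    assume "y \<in> {sH c 1 | c. True}"
    then obtain b where "y = sH b 1" by blast
    then have "x + y = sH (a + b) 1" by (simp add: a sH(2))
    then show "x + y \<in> {sH c 1 | c. True}" by blast
  qed
  ultimately show ?thesis by (auto simp: subcoalgebra_def)
qed

lemma linear_eq_on_direct_sum:
  assumes F: "internal_direct_sum F UNIV" "\<forall>N\<in>F. additive_subgroup N"
    and fg: "lin sH s f" "lin sH s g" and eq: "\<And>N x. N \<in> F \<Longrightarrow> x \<in> N \<Longrightarrow> f x = g x"
  shows "f x = g x"
proof -
  obtain c where c: "c \<in> direct_sum_carrier F" "x = support_sum c"
    using internal_direct_sumD(1)[OF F] by blast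
  have "f (c N) = g (c N)" if "N \<in> {N. c N \<noteq> 0}" for N
  proof (rule eq)
    show "N \<in> F" "c N \<in> N" using c(1) that unfolding direct_sum_carrier_def by blast+
  qed
  then show ?thesis
    unfolding c(2) support_sum_def linD(7)[OF fg(1)] linD(7)[OF fg(2)] by (intro sum.cong) auto
qed

text \<open>Let \<open>C\<close> be a summand in which \<open>1\<close> has a nonzero component, \<open>p\<close> the projection onto
  \<open>C\<close>, and \<open>\<phi>\<close> a functional with \<open>\<phi>(p(1)) = 1\<close>. Applying \<open>\<phi> p\<close> to the first factor of
  \<open>\<Delta>(1) = 1 \<otimes> 1\<close> gives \<open>1\<close>; it also gives an element of \<open>C\<close>, because \<open>\<Delta>\<close> maps every summand \<open>N\<close> into
  \<open>N \<otimes> N\<close> and \<open>p\<close> kills the summands other than \<open>C\<close>. Thus \<open>1 \<in> C\<close>, and \<open>C = k1\<close> by simplicity.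
  The defining property of a cointegral is then checked on each summand.\<close>

lemma exists_cointegral:
  assumes "cosemisimple_coalgebra H"
  shows "\<exists>l. cointegral l"
proof -
  obtain F where F: "\<forall>C\<in>F. simple_subcoalgebra H C" "internal_direct_sum F UNIV"
    using assms by (auto simp: cosemisimple_coalgebra_def)
  have co: "subcoalgebra H C" if "C \<in> F" for C using F(1) that by (simp add: simple_subcoalgebra_def)
  have sub: "\<forall>C\<in>F. module.subspace sH C" using co by (simp add: subcoalgebra_def)
  have grp: "\<forall>C\<in>F. additive_subgroup C"
    using subspaceD(1,4)[OF vector_space_H] sub by (simp add: additive_subgroup_def)
  obtain f where f: "f \<in> direct_sum_carrier F" "1 = support_sum f"
    using internal_direct_sumD(1)[OF F(2) grp] by blast
  have "support_sum f \<noteq> 0" unfolding f(2)[symmetric] by simp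
  then obtain C where fC: "f C \<noteq> 0" unfolding support_sum_def by (metis (mono_tags) mem_Collect_eq sum.neutral)
  then have C: "C \<in> F" using f(1) unfolding direct_sum_carrier_def by blast
  note C0 = subspaceD[OF vector_space_H sub[rule_format, OF C]]
  obtain p where p: "lin sH sH p" "\<And>x. p x \<in> C" "\<And>g. g \<in> direct_sum_carrier F \<Longrightarrow> p (support_sum g) = g C"
    using exists_component_projection[OF vector_space_H sub F(2) C] by blast
  have p_on: "p x = (if N = C then x else 0)" if "N \<in> F" "x \<in> N" for N x
    using p(3)[OF direct_sum_carrier_single[OF grp that]] unfolding support_sum_single by auto
  have p1: "p 1 = f C" using p(3)[OF f(1)] f(2) by simp
  have "1 \<in> C"
  proof -
    obtain \<phi> where \<phi>: "lin sH (*) \<phi>" "\<phi> (f C) = 1" using exists_functional[OF vector_space_H fC] by blast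
    note [linear_intros] = linear_comp[OF \<phi>(1)] linear_comp[OF p(1)]
    (* the pairing that applies phi p to the first tensor factor *)
    let ?b = "\<lambda>a b. sH (\<phi> (p a)) b"
    have bil: "bilin sH sH sH ?b" by (intro linear_intros)
    note sw_lin = linD[OF linear_sw[OF bil]]
    have "sw sH ?b (f N) \<in> C" if N: "f N \<noteq> 0" for N
    proof -
      have NF: "N \<in> F" "f N \<in> N" using f(1) N unfolding direct_sum_carrier_def by blast+
      obtain x where x: "Poly_Mapping.keys x \<subseteq> N \<times> N" "sw sH ?b (f N) = lin_extend sH (\<lambda>(a, b). ?b a b) x"
        using sw_subcoalgebra[OF co[OF NF(1)] NF(2) bil] by blast
      show ?thesis
        unfolding x(2)
      proof (rule lin_extend_mem[OF vector_space_H sub[rule_format, OF C]])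
        fix z assume "z \<in> Poly_Mapping.keys x"
        then obtain a b where z: "z = (a, b)" "a \<in> N" "b \<in> N" using x(1) by (cases z) auto
        show "(case z of (a, b) \<Rightarrow> ?b a b) \<in> C"
        proof (cases "N = C")
          case True
          then show ?thesis using z C0(3) by simp
        next
          case False
          then show ?thesis using z p_on[OF NF(1) z(2)] C0(1) by (simp add: linD(5)[OF \<phi>(1)] sH(5))
        qed
      qed
    qed
    then have "(\<Sum>N | f N \<noteq> 0. sw sH ?b (f N)) \<in> C" by (intro C0(5)) simp
    then have "sw sH ?b 1 \<in> C" unfolding f(2) support_sum_def sw_lin(7) .
    then show ?thesis by (simp add: sw_one[OF bil] p1 \<phi>(2) sH(4))
  qed
  then have "{sH c 1 | c. True} \<subseteq> C" using C0(3) by blast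
  moreover have "{sH c 1 | c. True} \<noteq> {0}"
  proof -
    have "1 \<in> {sH c 1 | c. True}" using sH(4)[of 1] by (metis (mono_tags) mem_Collect_eq)
    then show ?thesis using zero_neq_one singletonD by metis
  qed
  moreover have "\<forall>D. subcoalgebra H D \<and> D \<subseteq> C \<longrightarrow> D = {0} \<or> D = C"
    using F(1) C by (simp add: simple_subcoalgebra_def)
  ultimately have C1: "{sH c 1 | c. True} = C" using subcoalgebra_one by meson
  obtain \<phi> where \<phi>: "lin sH (*) \<phi>" "\<phi> 1 = 1" using exists_functional[OF vector_space_H, of 1] by auto
  define l where "l x = \<phi> (p x)" for x
  have l: "lin sH (*) l" unfolding l_def by (intro linear_comp[OF \<phi>(1)] p(1))
  note [linear_intros] = linear_comp[OF l]
  have l1: "l 1 = 1" using p_on[OF C \<open>1 \<in> C\<close>] by (simp add: l_def \<phi>(2))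
  let ?b = "\<lambda>a b. sH (l b) a"
  have bil: "bilin sH sH sH ?b" by (intro linear_intros)
  have "sw sH ?b h = sH (l h) 1" for h
  proof (rule linear_eq_on_direct_sum[where f = "sw sH ?b" and g = "\<lambda>h. sH (l h) 1" and s = sH, OF F(2) grp])
    show "lin sH sH (sw sH ?b)" by (rule linear_sw[OF bil])
    show "lin sH sH (\<lambda>h. sH (l h) 1)" by (intro linear_intros)
    fix N x assume N: "N \<in> F" "x \<in> N"
    show "sw sH ?b x = sH (l x) 1"
    proof (cases "N = C")
      case True
      then have "x \<in> {sH c 1 | c. True}" using N(2) C1 by simp
      then obtain c where "x = sH c 1" by blast
      then show ?thesis by (simp add: linD(4)[OF linear_sw[OF bil]] sw_one[OF bil] l1 linD(4)[OF l] sH(4))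
    next
      case False
      then have l0: "l y = 0" if "y \<in> N" for y
        using p_on[OF N(1) that] by (simp add: l_def linD(5)[OF \<phi>(1)])
      obtain z where z: "Poly_Mapping.keys z \<subseteq> N \<times> N" "sw sH ?b x = lin_extend sH (\<lambda>(a, b). ?b a b) z"
        using sw_subcoalgebra[OF co[OF N(1)] N(2) bil] by blast
      have "lin_extend sH (\<lambda>(a, b). ?b a b) z = lin_extend sH (\<lambda>_. 0) z"
        using z(1) l0 by (intro lin_extend_cong) (auto simp: sH(5))
      then show ?thesis using z(2) l0[OF N(2)] by (simp add: lin_extend_def sH(5,6))
    qed
  qed
  then show ?thesis using l l1 unfolding cointegral_def by (intro exI[of _ l] conjI allI)
qed

end

section \<open>Calculus of the coaction\<close>

text \<open>The map \<open>\<pi>\<close> is a linear projection onto the carrier. Composing the structure maps with it makes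
  them linear on the whole ambient space, where bilinearity can be stated without carriers.\<close>

locale long_calculus = hopf_calculus H for H :: "('k::field, 'h::ring_1) hopf" +
  fixes M :: "('k, 'h, 'm::ab_group_add) dimodule" and \<pi> :: "'m \<Rightarrow> 'm"
  assumes long: "long_dimodule H M"
    and linear_proj: "lin (mscale M) (mscale M) \<pi>"
    and proj_mem: "\<pi> x \<in> carrier M"
    and proj_id: "x \<in> carrier M \<Longrightarrow> \<pi> x = x"
begin

abbreviation "sM \<equiv> mscale M"
abbreviation "V \<equiv> carrier M"

definition ac :: "'h \<Rightarrow> 'm \<Rightarrow> 'm" where
  "ac h m = act M h (\<pi> m)"

definition co :: "('k \<Rightarrow> 'v::ab_group_add \<Rightarrow> 'v) \<Rightarrow> ('m \<Rightarrow> 'h \<Rightarrow> 'v) \<Rightarrow> 'm \<Rightarrow> 'v" where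
  "co s \<beta> m = lin_extend s (\<lambda>(n, h). \<beta> n h) (sweedlerM M (\<pi> m))"

lemma lmod: "left_module H M" and comod: "right_comodule H M"
  using long by (simp_all add: long_dimodule_def)

lemma vector_space_M [linear_intros]: "vector_space sM" and subspace_V: "module.subspace sM V"
  using lmod by (simp_all add: left_module_def k_space_def)

lemmas sM = vector_spaceD[OF vector_space_M]
lemmas V = subspaceD[OF vector_space_M subspace_V]

lemma act:
  assumes "m \<in> V"
  shows "act M h m \<in> V" "n \<in> V \<Longrightarrow> act M h (m + n) = act M h m + act M h n"
    "act M (g + h) m = act M g m + act M h m" "act M (g * h) m = act M g (act M h m)"
    "act M 1 m = m" "act M (sH c h) m = sM c (act M h m)" "act M h (sM c m) = sM c (act M h m)"
proof -
  note L = lmod[unfolded left_module_def]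
  show "act M h m \<in> V" "n \<in> V \<Longrightarrow> act M h (m + n) = act M h m + act M h n"
    "act M (g + h) m = act M g m + act M h m" "act M 1 m = m"
    using assms L by blast+
  have mult: "act M (g * h) m = act M g (act M h m)" for g h using assms L by blast
  then show "act M (g * h) m = act M g (act M h m)" .
  have scale: "act M (sH c h) m = sM c (act M h m)" for c h using assms L by blast
  then show "act M (sH c h) m = sM c (act M h m)" .
  have "sM c m = act M (sH c 1) m" using scale[of c 1] \<open>act M 1 m = m\<close> by simp
  then have "act M h (sM c m) = act M (h * sH c 1) m" by (simp add: mult)
  then show "act M h (sM c m) = sM c (act M h m)" by (simp add: scale_mult scale)
qed

lemma ac_eq: "m \<in> V \<Longrightarrow> ac h m = act M h m"
  by (simp add: ac_def proj_id)

lemma ac_mem: "ac h m \<in> V"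
  by (simp add: ac_def act(1) proj_mem)

lemma ac_mult: "ac (g * h) m = ac g (ac h m)"
  by (simp add: ac_eq ac_mem) (simp add: ac_def act(4) proj_mem)

lemma ac_one: "ac 1 m = \<pi> m"
  by (simp add: ac_def act(5) proj_mem)

lemma linear_ac [linear_intros]:
  "lin s sH f \<Longrightarrow> lin s sM (\<lambda>x. ac (f x) m)" "lin s sM g \<Longrightarrow> lin s sM (\<lambda>x. ac h (g x))"
proof -
  have "lin sH sM (\<lambda>h. ac h m)"
    unfolding Vector_Spaces.linear_iff ac_def
    by (simp add: vector_space_H vector_space_M act(3,6)[OF proj_mem])
  then show "lin s sH f \<Longrightarrow> lin s sM (\<lambda>x. ac (f x) m)" by (rule linear_comp)
  have "lin sM sM (\<lambda>m. ac h m)"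
    unfolding Vector_Spaces.linear_iff ac_def
    by (simp add: vector_space_M act(2,7) proj_mem linD(3,4)[OF linear_proj])
  then show "lin s sM g \<Longrightarrow> lin s sM (\<lambda>x. ac h (g x))" by (rule linear_comp)
qed

lemma sweedlerM:
  assumes "m \<in> V"
  shows "tensor2 sM sH (sweedlerM M m) = coact M m" "Poly_Mapping.keys (sweedlerM M m) \<subseteq> V \<times> UNIV"
proof -
  have "coact M m \<in> tensor_of sM sH V UNIV"
    using comod assms unfolding right_comodule_def by blast
  then show "tensor2 sM sH (sweedlerM M m) = coact M m" "Poly_Mapping.keys (sweedlerM M m) \<subseteq> V \<times> UNIV"
    by (fact sweedler_in_tensor_of)+
qed

lemma co_eqI:
  assumes "bilin sM sH s \<beta>" "m \<in> V" "coact M m = tensor2 sM sH x"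
  shows "co s \<beta> m = lin_extend s (\<lambda>(n, h). \<beta> n h) x"
  unfolding co_def proj_id[OF assms(2)]
  using trans[OF sweedlerM(1)[OF assms(2)] assms(3)] by (rule lin_extend_tensor2[OF assms(1)])

lemma co_proj: "co s \<beta> (\<pi> m) = co s \<beta> m"
  by (simp add: co_def proj_id proj_mem)

lemma co_cong:
  assumes "\<And>n h. n \<in> V \<Longrightarrow> \<beta> n h = \<beta>' n h"
  shows "co s \<beta> m = co s \<beta>' m"
  unfolding co_def using sweedlerM(2)[OF proj_mem] assms by (intro lin_extend_cong) auto

lemma co_mem:
  assumes "vector_space s" "module.subspace s N" "\<And>n h. n \<in> V \<Longrightarrow> \<beta> n h \<in> N"
  shows "co s \<beta> m \<in> N"
  unfolding co_def using sweedlerM(2)[OF proj_mem] assms(3) by (intro lin_extend_mem[OF assms(1,2)]) auto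

lemma linear_co:
  assumes "bilin sM sH s \<beta>"
  shows "lin sM s (co s \<beta>)"
  unfolding Vector_Spaces.linear_iff
proof (intro conjI allI)
  note l = linD[OF linear_lin_extend[OF bilinD(1)[OF assms]]]
  have eq: "co s \<beta> m = lin_extend s (\<lambda>(n, h). \<beta> n h) (sweedlerM M m)" if "m \<in> V" for m
    using that by (simp add: co_def proj_id)
  fix m n c
  have "coact M (\<pi> m + \<pi> n) = tensor2 sM sH (sweedlerM M (\<pi> m) + sweedlerM M (\<pi> n))"
    using comod proj_mem unfolding right_comodule_def by blast
  from co_eqI[OF assms _ this] have "co s \<beta> (\<pi> (m + n)) = co s \<beta> (\<pi> m) + co s \<beta> (\<pi> n)"
    by (simp add: linD(3)[OF linear_proj] V(2) proj_mem eq l(3))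
  then show "co s \<beta> (m + n) = co s \<beta> m + co s \<beta> n" by (simp add: co_proj)
  have "coact M (sM c (\<pi> m)) = tensor2 sM sH (fscale c (sweedlerM M (\<pi> m)))"
    using comod proj_mem unfolding right_comodule_def by blast
  from co_eqI[OF assms _ this] have "co s \<beta> (\<pi> (sM c m)) = s c (co s \<beta> (\<pi> m))"
    by (simp add: linD(4)[OF linear_proj] V(3) proj_mem eq l(4))
  then show "co s \<beta> (sM c m) = s c (co s \<beta> m)" by (simp add: co_proj)
qed (fact vector_space_M bilinD(1)[OF assms])+

lemma linear_co_arg [linear_intros]:
  "lin s1 sM f \<Longrightarrow> bilin sM sH s \<beta> \<Longrightarrow> lin s1 s (\<lambda>x. co s \<beta> (f x))"
  by (rule linear_comp[OF linear_co])

lemma linear_co_param [linear_intros]: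
  assumes "vector_space s1" "vector_space s" "\<And>a b. lin s1 s (\<lambda>x. \<beta> x a b)"
  shows "lin s1 s (\<lambda>x. co s (\<beta> x) m)"
  unfolding co_def by (rule linear_lin_extend_param) (use assms in \<open>simp_all add: case_prod_unfold\<close>)

lemma co_comp:
  assumes "lin s s' L"
  shows "L (co s \<beta> m) = co s' (\<lambda>n h. L (\<beta> n h)) m"
  unfolding co_def by (rule lin_extend_comp2[OF assms])

lemma co_sw_swap:
  assumes "vector_space s"
  shows "co s (\<lambda>n h. sw s (\<lambda>a b. \<beta> n h a b) g) m = sw s (\<lambda>a b. co s (\<lambda>n h. \<beta> n h a b) m) g"
  unfolding co_def sw_def by (rule lin_extend_swap2[OF assms])

lemma co_coassoc:
  assumes "trilin sM sH sH s \<tau>"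
  shows "co s (\<lambda>n h. co s (\<lambda>n0 n1. \<tau> n0 n1 h) n) m = co s (\<lambda>n h. sw s (\<lambda>a b. \<tau> n a b) h) m"
proof -
  have v: "vector_space s" using assms unfolding trilin_def by (blast dest: linD(2))
  have *: "lin_extend s (\<lambda>(n, h). lin_extend s (\<lambda>(n0, n1). \<tau> n0 n1 h) (sweedlerM M n)) (sweedlerM M (\<pi> m)) =
      lin_extend s (\<lambda>(n, h). lin_extend s (\<lambda>(a, b). \<tau> n a b) (sweedlerH H h)) (sweedlerM M (\<pi> m))"
  proof -
    have "tensor3 sM sH sH
          (lin_extend fscale (\<lambda>(n, h). lin_extend fscale (\<lambda>(n0, n1). Poly_Mapping.single (n0, n1, h) 1)
             (sweedlerM M n)) (sweedlerM M (\<pi> m))) =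
        tensor3 sM sH sH
          (lin_extend fscale (\<lambda>(n, h). lin_extend fscale (\<lambda>(h1, h2). Poly_Mapping.single (n, h1, h2) 1)
             (sweedlerH H h)) (sweedlerM M (\<pi> m)))"
      using comod proj_mem unfolding right_comodule_def by blast
    from lin_extend_tensor3[OF assms this] show ?thesis
      unfolding lin_extend_comp2[OF linear_lin_extend[OF v]] lin_extend_single[OF v]
      by (simp add: vector_spaceD(4)[OF v])
  qed
  have "co s (\<lambda>n h. co s (\<lambda>n0 n1. \<tau> n0 n1 h) n) m =
      lin_extend s (\<lambda>(n, h). lin_extend s (\<lambda>(n0, n1). \<tau> n0 n1 h) (sweedlerM M n)) (sweedlerM M (\<pi> m))"
    unfolding co_def using sweedlerM(2)[OF proj_mem[of m]] proj_id by (intro lin_extend_cong) auto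
  then show ?thesis unfolding * by (simp add: co_def sw_def)
qed

lemma co_counit:
  assumes "lin sM s L"
  shows "co s (\<lambda>n h. s (\<epsilon> h) (L n)) m = L (\<pi> m)"
proof -
  have "co sM (\<lambda>n h. sM (\<epsilon> h) n) m = \<pi> m"
    using comod proj_mem unfolding right_comodule_def co_def by blast
  from arg_cong[OF this, of L] show ?thesis by (simp add: co_comp[OF assms] linD(4)[OF assms])
qed

lemma co_ac:
  assumes "bilin sM sH s \<beta>"
  shows "co s \<beta> (ac h m) = co s (\<lambda>n x. \<beta> (ac h n) x) m"
proof -
  note v = bilinD(1)[OF assms]
  have "coact M (act M h (\<pi> m)) = tensor2 sM sH
      (lin_extend fscale (\<lambda>(m0, m1). Poly_Mapping.single (act M h m0, m1) 1) (sweedlerM M (\<pi> m)))"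
    using long proj_mem unfolding long_dimodule_def by blast
  from co_eqI[OF assms _ this] have "co s \<beta> (ac h m) = co s (\<lambda>n x. \<beta> (act M h n) x) m"
    unfolding lin_extend_comp2[OF linear_lin_extend[OF v]] lin_extend_single[OF v]
    by (simp add: ac_mem co_def vector_spaceD(4)[OF v] flip: ac_def)
  also have "\<dots> = co s (\<lambda>n x. \<beta> (ac h n) x) m"
    by (rule co_cong) (simp add: ac_eq)
  finally show ?thesis .
qed

text \<open>The action of the functionals on \<open>H\<close> that is equivalent to the coaction.\<close>

definition dual :: "('h \<Rightarrow> 'k) \<Rightarrow> 'm \<Rightarrow> 'm" where
  "dual f m = co sM (\<lambda>n h. sM (f h) n) m"

lemma linear_dual:
  assumes f: "lin sH (*) f" and g: "lin s sM g"
  shows "lin s sM (\<lambda>x. dual f (g x))"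
proof -
  note [linear_intros] = linear_comp[OF f]
  show ?thesis unfolding dual_def by (intro linear_intros g)
qed

lemma dual_counit: "dual \<epsilon> m = \<pi> m"
  unfolding dual_def by (rule co_counit[OF linear_ident[OF vector_space_M]])

lemma dual_ac:
  assumes f: "lin sH (*) f"
  shows "dual f (ac h m) = ac h (dual f m)"
proof -
  note [linear_intros] = linear_comp[OF f]
  have l: "lin sM sM (\<lambda>m. ac h m)" by (intro linear_intros)
  have "dual f (ac h m) = co sM (\<lambda>n x. sM (f x) (ac h n)) m"
    unfolding dual_def by (subst co_ac) (intro linear_intros, rule refl)
  also have "\<dots> = ac h (dual f m)"
    unfolding dual_def co_comp[OF l] by (simp add: linD(4)[OF l])
  finally show ?thesis .
qed

text \<open>The product of functionals that appears here is the convolution product.\<close>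

lemma dual_dual:
  assumes f: "lin sH (*) f" and g: "lin sH (*) g"
  shows "dual f (dual g m) = dual (\<lambda>h. sw (*) (\<lambda>a b. g b * f a) h) m"
proof -
  note [linear_intros] = linear_comp[OF f] linear_comp[OF g]
  have l: "lin sM sM (\<lambda>m. dual f m)" by (intro linear_dual f linear_intros)
  have scale: "lin sM sM (\<lambda>m. sM c m)" for c by (intro linear_intros)
  have "dual f (dual g m) = co sM (\<lambda>n h. sM (g h) (dual f n)) m"
    unfolding dual_def[of g] co_comp[OF l] by (simp add: linD(4)[OF l])
  also have "\<dots> = co sM (\<lambda>n h. co sM (\<lambda>n0 n1. sM (g h * f n1) n0) n) m"
    unfolding dual_def co_comp[OF scale] by (simp add: sM(3))
  also have "\<dots> = co sM (\<lambda>n h. sw sM (\<lambda>a b. sM (g b * f a) n) h) m"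
    by (rule co_coassoc) (intro linear_intros)
  also have "\<dots> = co sM (\<lambda>n h. sM (sw (*) (\<lambda>a b. g b * f a) h) n) m"
  proof -
    have "lin (*) sM (\<lambda>c. sM c n)" for n by (intro linear_intros)
    from sw_comp[OF this] show ?thesis by simp
  qed
  finally show ?thesis by (simp add: dual_def)
qed

text \<open>The coordinate functionals of a fixed basis of \<open>H\<close>.\<close>

definition coord :: "'h \<Rightarrow> 'h \<Rightarrow> 'k" where
  "coord b h = module.representation sH (vector_space.extend_basis sH {}) h b"

lemma coord:
  shows "lin sH (*) (coord b)" "finite {b. coord b h \<noteq> 0}" "(\<Sum>b | coord b h \<noteq> 0. sH (coord b h) b) = h"
proof -
  interpret vector_space sH by (rule vector_space_H)
  let ?B = "extend_basis {}"
  have B: "independent ?B" "span ?B = UNIV"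
    using independent_extend_basis span_extend_basis independent_empty by blast+
  show "lin sH (*) (coord b)" unfolding coord_def[abs_def] by (rule linear_representation[OF B])
  show "finite {b. coord b h \<noteq> 0}" unfolding coord_def by (rule finite_representation)
  show "(\<Sum>b | coord b h \<noteq> 0. sH (coord b h) b) = h"
    unfolding coord_def by (rule sum_nonzero_representation_eq[OF B(1)]) (simp add: B(2))
qed

text \<open>Finitely many basis elements, among them all those that occur in the coaction on \<open>m\<close>.\<close>

definition support :: "'m \<Rightarrow> 'h set" where
  "support m = (\<Union>z\<in>Poly_Mapping.keys (sweedlerM M (\<pi> m)). {b. coord b (snd z) \<noteq> 0})"

lemma finite_support: "finite (support m)"
  unfolding support_def using coord(2) by simp

text \<open>That is, \<open>\<rho>(m) = \<Sum> m\<^sub>b \<otimes> b\<close> with \<open>m\<^sub>b\<close> the result of the action of the coordinate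
  functional of \<open>b\<close> on \<open>m\<close>.\<close>

lemma co_expand:
  assumes \<beta>: "bilin sM sH s \<beta>"
  shows "co s \<beta> m = (\<Sum>b\<in>support m. \<beta> (dual (coord b) m) b)"
proof -
  note v = bilinD(1)[OF \<beta>]
  have l1: "lin sM s (\<lambda>n. \<beta> n b)" for b using \<beta> by (simp add: bilin_def)
  have l2: "lin sH s (\<lambda>h. \<beta> n h)" for n using \<beta> by (simp add: bilin_def)
  have *: "\<beta> n h = (\<Sum>b\<in>support m. \<beta> (sM (coord b h) n) b)"
    if "(n, h) \<in> Poly_Mapping.keys (sweedlerM M (\<pi> m))" for n h
  proof -
    have "{b. coord b h \<noteq> 0} \<subseteq> support m" using that unfolding support_def by force
    then have "(\<Sum>b | coord b h \<noteq> 0. sH (coord b h) b) = (\<Sum>b\<in>support m. sH (coord b h) b)"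
      by (intro sum.mono_neutral_left finite_support) (auto simp: sH(5))
    then have "h = (\<Sum>b\<in>support m. sH (coord b h) b)" using coord(3) by simp
    from arg_cong[OF this, of "\<beta> n"] show ?thesis
      unfolding linD(7)[OF l2] by (simp add: linD(4)[OF l2] linD(4)[OF l1])
  qed
  have "co s \<beta> m = lin_extend s (\<lambda>z. \<Sum>b\<in>support m. \<beta> (sM (coord b (snd z)) (fst z)) b) (sweedlerM M (\<pi> m))"
    unfolding co_def using * by (intro lin_extend_cong) auto
  also have "\<dots> = (\<Sum>b\<in>support m. co s (\<lambda>n h. \<beta> (sM (coord b h) n) b) m)"
    unfolding lin_extend_sum[OF v] co_def by (simp add: case_prod_unfold)
  also have "\<dots> = (\<Sum>b\<in>support m. \<beta> (dual (coord b) m) b)"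
    unfolding dual_def co_comp[OF l1] by simp
  finally show ?thesis .
qed

section \<open>Subobjects\<close>

definition stable :: "'m set \<Rightarrow> bool" where
  "stable N \<longleftrightarrow> N \<subseteq> V \<and> module.subspace sM N \<and> (\<forall>h. \<forall>n\<in>N. ac h n \<in> N) \<and>
     (\<forall>f. lin sH (*) f \<longrightarrow> (\<forall>n\<in>N. dual f n \<in> N))"

text \<open>Expand the coaction in a basis of \<open>H\<close>: the coefficients result from the action of functionals, so
  they lie in \<open>N\<close>.\<close>

lemma stable_coact:
  assumes N: "stable N" and n: "n \<in> N"
  shows "coact M n \<in> tensor_of sM sH N UNIV"
proof -
  have nV: "n \<in> V" using N n by (auto simp: stable_def)
  obtain q :: "('m \<times> 'h \<Rightarrow>\<^sub>0 'k) \<Rightarrow> ('m \<times> 'h \<Rightarrow>\<^sub>0 'k)"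
    where q: "lin fscale fscale q" "bilin sM sH fscale (\<lambda>v w. q (Poly_Mapping.single (v, w) 1))"
    "\<And>x y. tensor2 sM sH x = tensor2 sM sH y \<longleftrightarrow> q x = q y"
    using exists_universal_bilinear[OF vector_space_M vector_space_H] by blast
  let ?y = "\<Sum>b\<in>support n. Poly_Mapping.single (dual (coord b) n, b) (1 :: 'k)"
  have "q (sweedlerM M n) = co fscale (\<lambda>v w. q (Poly_Mapping.single (v, w) 1)) n"
    unfolding co_def proj_id[OF nV] by (subst linear_on_free[OF q(1)]) (simp add: case_prod_unfold)
  also have "\<dots> = q ?y" unfolding co_expand[OF q(2)] linD(7)[OF q(1)] ..
  finally have "tensor2 sM sH (sweedlerM M n) = tensor2 sM sH ?y" unfolding q(3) .
  then have "coact M n = tensor2 sM sH ?y" unfolding sweedlerM(1)[OF nV] .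
  moreover have "Poly_Mapping.keys ?y \<subseteq> N \<times> UNIV"
  proof
    fix z assume "z \<in> Poly_Mapping.keys ?y"
    then obtain b where "b \<in> support n" "z \<in> Poly_Mapping.keys (Poly_Mapping.single (dual (coord b) n, b) (1 :: 'k))"
      using Poly_Mapping.keys_sum[of "\<lambda>b. Poly_Mapping.single (dual (coord b) n, b) (1 :: 'k)" "support n"] by blast
    moreover have "dual (coord b) n \<in> N" using N n coord(1) unfolding stable_def by blast
    ultimately show "z \<in> N \<times> UNIV" by simp
  qed
  ultimately show ?thesis unfolding tensor_of_def by blast
qed

text \<open>Sums over the coaction may be computed from a representative inside \<open>N\<close>.\<close>

lemma stable_sweedler:
  assumes N: "stable N" and n: "n \<in> N"
  shows "tensor2 sM sH (sweedler (N \<times> UNIV) (coact M n)) = coact M n"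
    "Poly_Mapping.keys (sweedler (N \<times> UNIV) (coact M n)) \<subseteq> N \<times> UNIV"
    "bilin sM sH s \<beta> \<Longrightarrow> lin_extend s (\<lambda>(n, h). \<beta> n h) (sweedler (N \<times> UNIV) (coact M n)) = co s \<beta> n"
proof -
  show x: "tensor2 sM sH (sweedler (N \<times> UNIV) (coact M n)) = coact M n"
    "Poly_Mapping.keys (sweedler (N \<times> UNIV) (coact M n)) \<subseteq> N \<times> UNIV"
    by (fact sweedler_in_tensor_of[OF stable_coact[OF N n]])+
  have nV: "n \<in> V" using N n by (auto simp: stable_def)
  show "lin_extend s (\<lambda>(n, h). \<beta> n h) (sweedler (N \<times> UNIV) (coact M n)) = co s \<beta> n"
    if "bilin sM sH s \<beta>"
    using co_eqI[OF that nV x(1)[symmetric]] by (rule sym)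
qed

lemma restrict_to_simps:
  "carrier (restrict_to M N) = N" "mscale (restrict_to M N) = sM"
  "act (restrict_to M N) = act M" "coact (restrict_to M N) = coact M"
  by simp_all

text \<open>The axioms of a comodule are inherited from \<open>M\<close>, but the representatives chosen in them change.
  The tensor identities are therefore tested with a universal multilinear map, for which the choice is
  immaterial.\<close>

lemma stable_subobject:
  assumes N: "stable N"
  shows "subobject H M N"
proof -
  have NV: "N \<subseteq> V" and sub: "module.subspace sM N" and acN: "\<And>h n. n \<in> N \<Longrightarrow> act M h n \<in> N"
    using N ac_eq unfolding stable_def by (blast, blast, metis subsetD)
  note N0 = subspaceD[OF vector_space_M sub]
  let ?x = "\<lambda>n. sweedler (N \<times> UNIV) (coact M n)"
  note x = stable_sweedler(1,2)[OF N] and co_x = stable_sweedler(3)[OF N]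
  have xM: "tensor2 sM sH (sweedlerM M n) = tensor2 sM sH (?x n)" if "n \<in> N" for n
    unfolding x(1)[OF that] by (rule sweedlerM(1)) (use that NV in blast)
  have "left_module H (restrict_to M N)"
    unfolding left_module_def k_space_def
    using sub vector_space_M act(2-6) acN NV by (simp add: subset_iff)
  moreover have "right_comodule H (restrict_to M N)"
    unfolding right_comodule_def k_space_def restrict_to_simps
  proof (intro conjI ballI allI)
    show "vector_space sM" "module.subspace sM N" by (fact vector_space_M sub)+
    fix m assume m: "m \<in> N"
    then have mV: "m \<in> V" using NV by blast
    show "coact M m \<in> tensor_of sM sH N UNIV" by (rule stable_coact[OF N m])
    show "coact M (sM c m) = tensor2 sM sH (fscale c (?x m))" for c
    proof -
      have "coact M (sM c m) = tensor2 sM sH (fscale c (sweedlerM M m))"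
        using comod mV unfolding right_comodule_def by blast
      then show ?thesis using tensor2_cong(2)[OF xM[OF m]] by simp
    qed
    show "coact M (m + n) = tensor2 sM sH (?x m + ?x n)" if n: "n \<in> N" for n
    proof -
      have "coact M (m + n) = tensor2 sM sH (sweedlerM M m + sweedlerM M n)"
        using comod mV n NV unfolding right_comodule_def by blast
      then show ?thesis using tensor2_cong(1)[OF xM[OF m] xM[OF n]] by simp
    qed
    show "lin_extend sM (\<lambda>(n, h). sM (\<epsilon> h) n) (?x m) = m"
    proof -
      have "bilin sM sH sM (\<lambda>n h. sM (\<epsilon> h) n)" by (intro linear_intros)
      from co_x[OF m this] show ?thesis
        unfolding co_counit[OF linear_ident[OF vector_space_M]] proj_id[OF mV] .
    qed
    obtain q :: "('m \<times> 'h \<times> 'h \<Rightarrow>\<^sub>0 'k) \<Rightarrow> ('m \<times> 'h \<times> 'h \<Rightarrow>\<^sub>0 'k)"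
      where q: "lin fscale fscale q"
      "trilin sM sH sH fscale (\<lambda>u v w. q (Poly_Mapping.single (u, v, w) 1))"
      "\<And>x y. tensor3 sM sH sH x = tensor3 sM sH sH y \<longleftrightarrow> q x = q y"
      using exists_universal_trilinear[OF vector_space_M vector_space_H vector_space_H] by blast
    define \<tau> where "\<tau> u v w = q (Poly_Mapping.single (u, v, w) 1)" for u v w
    have tri: "trilin sM sH sH fscale \<tau>" using q(2) by (simp add: \<tau>_def[abs_def])
    have \<tau>1: "lin sM fscale (\<lambda>u. \<tau> u v w)" for v w using tri by (simp add: trilin_def)
    have \<tau>2: "lin sH fscale (\<lambda>v. \<tau> u v w)" for u w using tri by (simp add: trilin_def)
    have \<tau>3: "lin sH fscale (\<lambda>w. \<tau> u v w)" for u v using tri by (simp add: trilin_def)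
    note [linear_intros] = linear_comp[OF \<tau>1] linear_comp[OF \<tau>2] linear_comp[OF \<tau>3] vector_space_fscale
    have "q (lin_extend fscale (\<lambda>(n, h). lin_extend fscale (\<lambda>(n0, n1). Poly_Mapping.single (n0, n1, h) 1) (?x n)) (?x m)) =
        lin_extend fscale (\<lambda>(n, h). lin_extend fscale (\<lambda>(n0, n1). \<tau> n0 n1 h) (?x n)) (?x m)"
      unfolding lin_extend_comp2[OF q(1)] by (simp add: \<tau>_def)
    also have "\<dots> = lin_extend fscale (\<lambda>(n, h). co fscale (\<lambda>n0 n1. \<tau> n0 n1 h) n) (?x m)"
    proof (rule lin_extend_cong)
      fix z assume "z \<in> Poly_Mapping.keys (?x m)"
      then obtain n h where z: "z = (n, h)" "n \<in> N" using x(2)[OF m] by (cases z) auto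
      have "bilin sM sH fscale (\<lambda>n0 n1. \<tau> n0 n1 h)" by (intro linear_intros)
      from co_x[OF z(2) this] show "(case z of (n, h) \<Rightarrow> lin_extend fscale (\<lambda>(n0, n1). \<tau> n0 n1 h) (?x n)) =
          (case z of (n, h) \<Rightarrow> co fscale (\<lambda>n0 n1. \<tau> n0 n1 h) n)" by (simp add: z(1))
    qed
    also have "\<dots> = co fscale (\<lambda>n h. co fscale (\<lambda>n0 n1. \<tau> n0 n1 h) n) m"
      by (rule co_x[OF m]) (intro linear_intros)
    also have "\<dots> = co fscale (\<lambda>n h. sw fscale (\<lambda>a b. \<tau> n a b) h) m" by (rule co_coassoc[OF tri])
    also have "\<dots> = lin_extend fscale (\<lambda>(n, h). sw fscale (\<lambda>a b. \<tau> n a b) h) (?x m)"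
      by (rule co_x[OF m, symmetric]) (intro linear_intros)
    also have "\<dots> = q (lin_extend fscale (\<lambda>(n, h). lin_extend fscale (\<lambda>(h1, h2). Poly_Mapping.single (n, h1, h2) 1)
        (sweedlerH H h)) (?x m))"
      unfolding lin_extend_comp2[OF q(1)] by (simp add: \<tau>_def sw_def)
    finally show "tensor3 sM sH sH
        (lin_extend fscale (\<lambda>(n, h). lin_extend fscale (\<lambda>(n0, n1). Poly_Mapping.single (n0, n1, h) 1) (?x n)) (?x m)) =
      tensor3 sM sH sH (lin_extend fscale (\<lambda>(n, h). lin_extend fscale (\<lambda>(h1, h2). Poly_Mapping.single (n, h1, h2) 1)
        (sweedlerH H h)) (?x m))"
      unfolding q(3) .
  qed
  moreover have "coact M (act M h m) = tensor2 sM sH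
      (lin_extend fscale (\<lambda>(m0, m1). Poly_Mapping.single (act M h m0, m1) 1) (?x m))" if m: "m \<in> N" for m h
  proof -
    have mV: "m \<in> V" using m NV by blast
    obtain q :: "('m \<times> 'h \<Rightarrow>\<^sub>0 'k) \<Rightarrow> ('m \<times> 'h \<Rightarrow>\<^sub>0 'k)"
      where q: "lin fscale fscale q" "bilin sM sH fscale (\<lambda>v w. q (Poly_Mapping.single (v, w) 1))"
      "\<And>x y. tensor2 sM sH x = tensor2 sM sH y \<longleftrightarrow> q x = q y"
      using exists_universal_bilinear[OF vector_space_M vector_space_H] by blast
    note [linear_intros] = bilinD(4,5)[OF q(2)]
    have "q (sweedlerM M (act M h m)) = co fscale (\<lambda>v w. q (Poly_Mapping.single (v, w) 1)) (ac h m)"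
      unfolding co_def ac_eq[OF mV] proj_id[OF act(1)[OF mV]]
      by (subst linear_on_free[OF q(1)]) (simp add: case_prod_unfold)
    also have "\<dots> = co fscale (\<lambda>n w. q (Poly_Mapping.single (ac h n, w) 1)) m"
      by (rule co_ac[OF q(2)])
    also have "\<dots> = lin_extend fscale (\<lambda>(n, w). q (Poly_Mapping.single (ac h n, w) 1)) (?x m)"
      by (rule co_x[OF m, symmetric]) (intro linear_intros)
    also have "\<dots> = lin_extend fscale (\<lambda>(n, w). q (Poly_Mapping.single (act M h n, w) 1)) (?x m)"
      using x(2)[OF m] NV ac_eq by (intro lin_extend_cong) auto
    also have "\<dots> = q (lin_extend fscale (\<lambda>(m0, m1). Poly_Mapping.single (act M h m0, m1) 1) (?x m))"
      unfolding lin_extend_comp2[OF q(1)] ..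
    finally have "tensor2 sM sH (sweedlerM M (act M h m)) = tensor2 sM sH
        (lin_extend fscale (\<lambda>(m0, m1). Poly_Mapping.single (act M h m0, m1) 1) (?x m))"
      unfolding q(3) .
    then show ?thesis unfolding sweedlerM(1)[OF act(1)[OF mV]] .
  qed
  ultimately show ?thesis using NV by (simp add: subobject_def long_dimodule_def)
qed

lemma subobject_lin_extend:
  assumes N: "subobject H M N" and n: "n \<in> N" and \<beta>: "bilin sM sH s \<beta>"
  shows "\<exists>x. Poly_Mapping.keys x \<subseteq> N \<times> UNIV \<and> co s \<beta> n = lin_extend s (\<lambda>(n, h). \<beta> n h) x"
proof -
  have "right_comodule H (restrict_to M N)" and NV: "N \<subseteq> V"
    using N by (simp_all add: subobject_def long_dimodule_def)
  then have "coact M n \<in> tensor_of sM sH N UNIV"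
    using n by (simp add: right_comodule_def)
  then obtain x where "coact M n = tensor2 sM sH x" "Poly_Mapping.keys x \<subseteq> N \<times> UNIV"
    by (auto simp: tensor_of_def)
  then show ?thesis using co_eqI[OF \<beta>] n NV by blast
qed

lemma subobject_iff_stable: "subobject H M N \<longleftrightarrow> stable N"
proof
  assume N: "subobject H M N"
  then have NV: "N \<subseteq> V" and "left_module H (restrict_to M N)"
    by (simp_all add: subobject_def long_dimodule_def)
  then have sub: "module.subspace sM N" and actN: "\<And>h n. n \<in> N \<Longrightarrow> act M h n \<in> N"
    by (simp_all add: left_module_def k_space_def)
  have "dual f n \<in> N" if f: "lin sH (*) f" and n: "n \<in> N" for f n
  proof -
    note [linear_intros] = linear_comp[OF f]
    have "bilin sM sH sM (\<lambda>n h. sM (f h) n)" by (intro linear_intros)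
    from subobject_lin_extend[OF N n this]
    obtain x where x: "Poly_Mapping.keys x \<subseteq> N \<times> UNIV" "dual f n = lin_extend sM (\<lambda>(n, h). sM (f h) n) x"
      unfolding dual_def by blast
    show ?thesis unfolding x(2)
      using x(1) subspaceD(3)[OF vector_space_M sub] by (intro lin_extend_mem[OF vector_space_M sub]) auto
  qed
  then show "stable N" using NV sub actN ac_eq by (auto simp: stable_def subset_iff)
qed (rule stable_subobject)

section \<open>Complements of subobjects\<close>

lemma stableD:
  assumes "stable N"
  shows "N \<subseteq> V" "module.subspace sM N" "n \<in> N \<Longrightarrow> ac h n \<in> N" "lin sH (*) f \<Longrightarrow> n \<in> N \<Longrightarrow> dual f n \<in> N"
  using assms unfolding stable_def by blast+

lemma dual_mem: "dual f m \<in> V"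
  unfolding dual_def by (rule co_mem[OF vector_space_M subspace_V]) (rule V(3))

text \<open>Average a linear projection \<open>p\<close> over the cointegral. That \<open>P\<close> fixes \<open>n \<in> N\<close> is the identity
  \<open>\<Sum> l(n\<^sub>1 S(n\<^sub>2)) n\<^sub>0 = \<Sum> \<epsilon>(n\<^sub>1) n\<^sub>0 = n\<close>; that \<open>P\<close> commutes with functionals is \<open>cointegral_slide\<close> applied to
  \<open>g = p(m\<^sub>0)\<^sub>1\<close> and \<open>h = m\<^sub>1\<close>.\<close>

lemma colinear_projection:
  assumes l: "cointegral l" and N: "stable N"
  shows "\<exists>P. lin sM sM P \<and> (\<forall>m. P m \<in> N) \<and> (\<forall>n\<in>N. P n = n) \<and>
    (\<forall>f m. lin sH (*) f \<longrightarrow> dual f (P m) = P (dual f m))"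
proof -
  note N0 = stableD[OF N]
  obtain p where p: "lin sM sM p" "\<And>x. p x \<in> N" "\<And>x. x \<in> N \<Longrightarrow> p x = x"
    using exists_projection[OF vector_space_M N0(2)] by blast
  have l': "lin sH (*) l" and l1: "l 1 = 1" using l by (simp_all add: cointegral_def)
  note [linear_intros] = linear_comp[OF p(1)] linear_comp[OF l']
  have scale: "lin sM sM (\<lambda>m. sM c m)" for c by (intro linear_intros)
  define E where "E n h = co sM (\<lambda>n' h'. sM (l (h' * S h)) n') (p n)" for n h
  have E1: "lin sM sM (\<lambda>n. E n h)" for h unfolding E_def by (intro linear_intros)
  have E2: "lin sH sM (\<lambda>h. E n h)" for n unfolding E_def by (intro linear_intros)
  note [linear_intros] = linear_comp[OF E1] linear_comp[OF E2]
  define P where "P m = co sM E m" for m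
  have P: "lin sM sM P" unfolding P_def[abs_def] by (rule linear_co) (intro linear_intros)
  have "P m \<in> N" for m
    unfolding P_def
  proof (rule co_mem[OF vector_space_M N0(2)])
    fix n h
    have "lin sH (*) (\<lambda>h'. l (h' * S h))" by (intro linear_intros)
    from N0(4)[OF this p(2)] show "E n h \<in> N" unfolding E_def dual_def .
  qed
  moreover have "P n = n" if n: "n \<in> N" for n
  proof -
    have nV: "n \<in> V" using n N0(1) by blast
    have bil: "bilin sM sH sM (\<lambda>n0 h. co sM (\<lambda>n' h'. sM (l (h' * S h)) n') n0)" by (intro linear_intros)
    have bilE: "bilin sM sH sM E" by (intro linear_intros)
    have "P n = co sM (\<lambda>n0 h. co sM (\<lambda>n' h'. sM (l (h' * S h)) n') n0) n"
      unfolding P_def stable_sweedler(3)[OF N n bilE, symmetric] stable_sweedler(3)[OF N n bil, symmetric]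
      by (rule lin_extend_cong) (use stable_sweedler(2)[OF N n] p(3) in \<open>auto simp: E_def\<close>)
    also have "\<dots> = co sM (\<lambda>n' w. sw sM (\<lambda>a b. sM (l (a * S b)) n') w) n"
      by (rule co_coassoc) (intro linear_intros)
    also have "\<dots> = co sM (\<lambda>n' w. sM (\<epsilon> w) (sM (l 1) n')) n"
      by (subst sw_antipode(2)) (intro linear_intros, rule refl)
    also have "\<dots> = n"
      unfolding l1 sM(4) co_counit[OF linear_ident[OF vector_space_M]] by (rule proj_id[OF nV])
    finally show ?thesis .
  qed
  moreover have "dual f (P m) = P (dual f m)" if f: "lin sH (*) f" for f m
  proof -
    note [linear_intros] = linear_comp[OF f]
    have d: "lin sM sM (\<lambda>m. dual f m)" by (rule linear_dual[OF f]) (intro linear_intros)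
    have inner: "dual f (E n h) = sw sM (\<lambda>a b. sM (f b) (E n a)) h" for n h
    proof -
      have "dual f (E n h) = co sM (\<lambda>n' h'. sM (l (h' * S h)) (dual f n')) (p n)"
        unfolding E_def co_comp[OF d] linD(4)[OF d] ..
      also have "\<dots> = co sM (\<lambda>n' h'. co sM (\<lambda>n0 n1. sM (l (h' * S h)) (sM (f n1) n0)) n') (p n)"
        unfolding dual_def co_comp[OF scale] ..
      also have "\<dots> = co sM (\<lambda>n' h'. sw sM (\<lambda>a b. sM (l (b * S h)) (sM (f a) n')) h') (p n)"
        by (rule co_coassoc) (intro linear_intros)
      also have "\<dots> = co sM (\<lambda>n' h'. sw sM (\<lambda>a b. sM (l (h' * S a)) (sM (f b) n')) h) (p n)"
        by (subst cointegral_slide[OF l]) (intro linear_intros, rule refl)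
      also have "\<dots> = sw sM (\<lambda>a b. co sM (\<lambda>n' h'. sM (l (h' * S a)) (sM (f b) n')) (p n)) h"
        by (rule co_sw_swap[OF vector_space_M])
      also have "\<dots> = sw sM (\<lambda>a b. sM (f b) (E n a)) h"
        unfolding E_def co_comp[OF scale] sM(3) by (simp add: mult.commute)
      finally show ?thesis .
    qed
    have "dual f (P m) = co sM (\<lambda>n h. sw sM (\<lambda>a b. sM (f b) (E n a)) h) m"
      unfolding P_def co_comp[OF d] inner ..
    also have "\<dots> = co sM (\<lambda>n h. co sM (\<lambda>n0 n1. sM (f h) (E n0 n1)) n) m"
      by (rule co_coassoc[symmetric]) (intro linear_intros)
    also have "\<dots> = co sM (\<lambda>n h. sM (f h) (P n)) m"
      unfolding P_def co_comp[OF scale] ..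
    also have "\<dots> = P (dual f m)"
      unfolding dual_def co_comp[OF P] linD(4)[OF P] ..
    finally show ?thesis .
  qed
  ultimately show ?thesis using P by blast
qed

text \<open>Average the colinear projection over the integral \<open>t\<close>. The result commutes with functionals because
  these commute with the action of \<open>H\<close>.\<close>

lemma equivariant_projection:
  assumes t: "\<And>h. h * t = sH (\<epsilon> h) t" "\<epsilon> t = 1" and l: "cointegral l" and N: "stable N"
  shows "\<exists>A. lin sM sM A \<and> (\<forall>m. A m \<in> N) \<and> (\<forall>n\<in>N. A n = n) \<and>
    (\<forall>f m. lin sH (*) f \<longrightarrow> dual f (A m) = A (dual f m)) \<and> (\<forall>h m. ac h (A m) = A (ac h m))"
proof -
  note N0 = stableD[OF N]
  obtain P where P: "lin sM sM P" "\<And>m. P m \<in> N" "\<And>n. n \<in> N \<Longrightarrow> P n = n"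
    "\<And>f m. lin sH (*) f \<Longrightarrow> dual f (P m) = P (dual f m)"
    using colinear_projection[OF l N] by blast
  note [linear_intros] = linear_comp[OF P(1)]
  define A where "A m = sw sM (\<lambda>a b. ac a (P (ac (S b) m))) t" for m
  have A: "lin sM sM A" unfolding A_def[abs_def] by (intro linear_intros)
  have "A m \<in> N" for m
    unfolding A_def sw_def
    by (rule lin_extend_mem[OF vector_space_M N0(2)]) (simp add: case_prod_unfold N0(3) P(2))
  moreover have "A n = n" if n: "n \<in> N" for n
  proof -
    have nV: "n \<in> V" using n N0(1) by blast
    have "A n = sw sM (\<lambda>a b. ac (a * S b) n) t"
      unfolding A_def P(3)[OF N0(3)[OF n]] ac_mult ..
    also have "\<dots> = sM (\<epsilon> t) (ac 1 n)"
      by (rule sw_antipode(2)) (intro linear_intros)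
    finally show ?thesis by (simp add: t(2) sM(4) ac_one proj_id[OF nV])
  qed
  moreover have "dual f (A m) = A (dual f m)" if f: "lin sH (*) f" for f m
  proof -
    have d: "lin sM sM (\<lambda>m. dual f m)" by (rule linear_dual[OF f]) (intro linear_intros)
    show ?thesis unfolding A_def sw_comp[OF d] by (simp add: dual_ac[OF f] P(4)[OF f])
  qed
  moreover have "ac h (A m) = A (ac h m)" for h m
  proof -
    have ach: "lin sM sM (\<lambda>m. ac h m)" by (intro linear_intros)
    have bil: "bilin sH sH sM (\<lambda>a b. ac a (P (ac b m)))" by (intro linear_intros)
    have "ac h (A m) = sw sM (\<lambda>a b. ac (h * a) (P (ac (S b) m))) t"
      unfolding A_def sw_comp[OF ach] ac_mult ..
    also have "\<dots> = sw sM (\<lambda>a b. ac a (P (ac (S b * h) m))) t"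
      by (rule integral_slide[OF t(1) bil])
    finally show ?thesis unfolding A_def ac_mult .
  qed
  ultimately show ?thesis using A by blast
qed

lemma stable_complement:
  assumes t: "\<And>h. h * t = sH (\<epsilon> h) t" "\<epsilon> t = 1" and l: "cointegral l" and N: "stable N"
  shows "\<exists>K. stable K \<and> N \<inter> K = {0} \<and> V = {a + b | a b. a \<in> N \<and> b \<in> K}"
proof -
  note N0 = stableD[OF N] and Nsub = subspaceD[OF vector_space_M stableD(2)[OF N]]
  obtain A where A: "lin sM sM A" "\<And>m. A m \<in> N" "\<And>n. n \<in> N \<Longrightarrow> A n = n"
    "\<And>f m. lin sH (*) f \<Longrightarrow> dual f (A m) = A (dual f m)" "\<And>h m. ac h (A m) = A (ac h m)"
    using equivariant_projection[OF t l N] by blast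
  let ?K = "{m \<in> V. A m = 0}"
  have "module.subspace sM ?K"
    unfolding subspace_iff[OF vector_space_M] using V(1-3) by (simp add: linD(3-5)[OF A(1)] sM(6))
  moreover have "ac h m \<in> ?K" if "m \<in> ?K" for h m
  proof -
    have "lin sM sM (\<lambda>m. ac h m)" by (intro linear_intros)
    then show ?thesis using that by (simp add: ac_mem A(5)[symmetric] linD(5)[of sM sM "\<lambda>m. ac h m"])
  qed
  moreover have "dual f m \<in> ?K" if "m \<in> ?K" "lin sH (*) f" for f m
  proof -
    have "lin sM sM (\<lambda>m. dual f m)" by (rule linear_dual[OF that(2)]) (intro linear_intros)
    then show ?thesis using that by (simp add: dual_mem A(4)[OF that(2), symmetric] linD(5)[of sM sM "\<lambda>m. dual f m"])
  qed
  ultimately have "stable ?K" by (simp add: stable_def)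
  moreover have "N \<inter> ?K = {0}"
    using A(3) Nsub(1) V(1) linD(5)[OF A(1)] by auto
  moreover have "V \<subseteq> {a + b | a b. a \<in> N \<and> b \<in> ?K}"
  proof
    fix m assume m: "m \<in> V"
    have "A m \<in> V" using A(2) N0(1) by blast
    then have "m - A m \<in> ?K" using m V(4) by (simp add: linD(6)[OF A(1)] A(3)[OF A(2)])
    moreover have "m = A m + (m - A m)" by simp
    ultimately show "m \<in> {a + b | a b. a \<in> N \<and> b \<in> ?K}" using A(2) by blast
  qed
  moreover have "{a + b | a b. a \<in> N \<and> b \<in> ?K} \<subseteq> V"
    using N0(1) V(2) by blast
  ultimately have "V = {a + b | a b. a \<in> N \<and> b \<in> ?K}" by (intro subset_antisym)
  with \<open>stable ?K\<close> \<open>N \<inter> ?K = {0}\<close> show ?thesis by (intro exI[of _ ?K] conjI)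
qed

lemma complemented_subgroups_stable:
  assumes t: "\<And>h. h * t = sH (\<epsilon> h) t" "\<epsilon> t = 1" and l: "cointegral l"
  shows "complemented_subgroups {N. stable N} V"
proof
  have dual_lin: "lin sM sM (\<lambda>m. dual f m)" if "lin sH (*) f" for f
    by (rule linear_dual[OF that]) (intro linear_intros)
  have ac_lin: "lin sM sM (\<lambda>m. ac h m)" for h by (intro linear_intros)
  note dual = linD[OF dual_lin] and ac = linD[OF ac_lin]
  have stableI: "stable N" if "N \<subseteq> V" "0 \<in> N" "\<And>x y. x \<in> N \<Longrightarrow> y \<in> N \<Longrightarrow> x + y \<in> N"
    "\<And>c x. x \<in> N \<Longrightarrow> sM c x \<in> N" "\<And>h x. x \<in> N \<Longrightarrow> ac h x \<in> N"
    "\<And>f x. lin sH (*) f \<Longrightarrow> x \<in> N \<Longrightarrow> dual f x \<in> N" for N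
    unfolding stable_def subspace_iff[OF vector_space_M] using that by simp
  show "additive_subgroup N" if "N \<in> {N. stable N}" for N
    using that subspaceD(1,4)[OF vector_space_M stableD(2)] by (simp add: additive_subgroup_def)
  show "N \<subseteq> V" if "N \<in> {N. stable N}" for N using that stableD(1) by blast
  have "stable {0}" by (rule stableI) (simp_all add: V(1) sM(6) dual(5) ac(5))
  then show "{0} \<in> {N. stable N}" by simp
  show "A \<inter> B \<in> {N. stable N}" if "A \<in> {N. stable N}" "B \<in> {N. stable N}" for A B
  proof -
    have AB: "stable A" "stable B" using that by simp_all
    note A = stableD[OF AB(1)] subspaceD[OF vector_space_M stableD(2)[OF AB(1)]]
    note B = stableD[OF AB(2)] subspaceD[OF vector_space_M stableD(2)[OF AB(2)]]
    have "stable (A \<inter> B)"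
      by (rule stableI) (use A(1) in blast, simp_all add: A(3-8) B(3-8))
    then show ?thesis by simp
  qed
  show "{a + b | a b. a \<in> A \<and> b \<in> B} \<in> {N. stable N}"
    if "A \<in> {N. stable N}" "B \<in> {N. stable N}" for A B
  proof -
    have AB: "stable A" "stable B" using that by simp_all
    note A = stableD[OF AB(1)] subspaceD[OF vector_space_M stableD(2)[OF AB(1)]]
    note B = stableD[OF AB(2)] subspaceD[OF vector_space_M stableD(2)[OF AB(2)]]
    let ?C = "{a + b | a b. a \<in> A \<and> b \<in> B}"
    have I: "a + b \<in> ?C" if "a \<in> A" "b \<in> B" for a b using that by blast
    have "stable ?C"
    proof (rule stableI)
      show "?C \<subseteq> V" using A(1) B(1) V(2) by blast
      show "0 \<in> ?C" using I[OF A(5) B(5)] by simp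
      fix x assume "x \<in> ?C"
      then obtain a b where x: "a \<in> A" "b \<in> B" "x = a + b" by blast
      show "sM c x \<in> ?C" for c unfolding x(3) sM(1) by (intro I A(7) B(7) x)
      show "ac h x \<in> ?C" for h unfolding x(3) ac(3) by (intro I A(3) B(3) x)
      show "dual f x \<in> ?C" if f: "lin sH (*) f" for f
        unfolding x(3) dual(3)[OF f] by (intro I A(4)[OF f] B(4)[OF f] x)
      fix y assume "y \<in> ?C"
      then obtain a' b' where y: "a' \<in> A" "b' \<in> B" "y = a' + b'" by blast
      have "x + y = (a + a') + (b + b')" unfolding x(3) y(3) by simp
      then show "x + y \<in> ?C" using I[OF A(6)[OF x(1) y(1)] B(6)[OF x(2) y(2)]] by simp
    qed
    then show ?thesis by simp
  qed
  show "\<Union>D \<in> {N. stable N}"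
    if D: "D \<subseteq> {N. stable N}" "D \<noteq> {}" "\<And>A B. A \<in> D \<Longrightarrow> B \<in> D \<Longrightarrow> \<exists>C\<in>D. A \<union> B \<subseteq> C" for D
  proof -
    have st: "stable N" if "N \<in> D" for N using D(1) that by blast
    have "stable (\<Union>D)"
    proof (rule stableI)
      show "\<Union>D \<subseteq> V" using st stableD(1) by blast
      show "0 \<in> \<Union>D"
        using D(2) st subspaceD(1)[OF vector_space_M stableD(2)] by blast
      fix x assume "x \<in> \<Union>D"
      then obtain N where N: "N \<in> D" "x \<in> N" by blast
      note N0 = stableD[OF st[OF N(1)]]
      show "sM c x \<in> \<Union>D" for c using N(1) subspaceD(3)[OF vector_space_M N0(2) N(2)] by blast
      show "ac h x \<in> \<Union>D" for h using N(1) N0(3)[OF N(2)] by blast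
      show "dual f x \<in> \<Union>D" if "lin sH (*) f" for f using N(1) N0(4)[OF that N(2)] by blast
      fix y assume "y \<in> \<Union>D"
      then obtain N' where N': "N' \<in> D" "y \<in> N'" by blast
      obtain C where C: "C \<in> D" "N \<union> N' \<subseteq> C" using D(3)[OF N(1) N'(1)] by blast
      have "x + y \<in> C"
        by (rule subspaceD(2)[OF vector_space_M stableD(2)[OF st[OF C(1)]]]) (use C(2) N(2) N'(2) in blast)+
      then show "x + y \<in> \<Union>D" using C(1) by blast
    qed
    then show ?thesis by simp
  qed
  show "\<exists>B\<in>{N. stable N}. A \<inter> B = {0} \<and> V = {a + b | a b. a \<in> A \<and> b \<in> B}"
    if "A \<in> {N. stable N}" for A
  proof -
    have "stable A" using that by simp
    from stable_complement[OF t l this] show ?thesis by (simp only: bex_simps mem_Collect_eq Bex_def)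
  qed
qed

section \<open>Finite generation\<close>

lemma dual_in_subspace:
  assumes W: "module.subspace sM W" "\<And>b. b \<in> support m \<Longrightarrow> dual (coord b) m \<in> W" and f: "lin sH (*) f"
  shows "dual f m \<in> W"
proof -
  note [linear_intros] = linear_comp[OF f]
  have bil: "bilin sM sH sM (\<lambda>n h. sM (f h) n)" by (intro linear_intros)
  show ?thesis unfolding dual_def[of f] co_expand[OF bil]
    using W(2) by (intro subspaceD(3,5)[OF vector_space_M W(1)])
qed

text \<open>The submodule generated by the coefficients of \<open>\<rho>(m)\<close> is a subcomodule: the functionals commute with
  the action of \<open>H\<close>, and a functional applied to a coefficient of \<open>m\<close> is again a combination of
  coefficients, by \<open>dual_dual\<close>.\<close>

lemma finitely_generated_stable:
  assumes N: "stable N" and m: "m \<in> N"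
  shows "\<exists>X. finite X \<and> X \<subseteq> N \<and> m \<in> {\<Sum>x\<in>X. ac (g x) x | g. True} \<and> stable {\<Sum>x\<in>X. ac (g x) x | g. True}"
proof -
  note N0 = stableD[OF N]
  have mV: "m \<in> V" using m N0(1) by blast
  let ?X = "(\<lambda>b. dual (coord b) m) ` support m"
  let ?W = "{\<Sum>x\<in>?X. ac (g x) x | g. True}"
  have finX: "finite ?X" using finite_support by simp
  have XN: "?X \<subseteq> N" using N0(4)[OF coord(1) m] by blast
  have acl: "lin sH sM (\<lambda>h. ac h x)" for x by (intro linear_intros)
  have ach: "lin sM sM (\<lambda>x. ac h x)" for h by (intro linear_intros)
  note acl = linD[OF acl] and ach = linD[OF ach]
  have I: "(\<Sum>x\<in>?X. ac (g x) x) \<in> ?W" for g by blast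
  have sub: "module.subspace sM ?W"
    unfolding subspace_iff[OF vector_space_M]
  proof (intro conjI ballI allI)
    show "0 \<in> ?W" using I[of "\<lambda>_. 0"] by (simp add: acl(5))
    fix x c assume "x \<in> ?W"
    then obtain g where g: "x = (\<Sum>x\<in>?X. ac (g x) x)" by blast
    show "sM c x \<in> ?W" using I[of "\<lambda>x. sH c (g x)"] by (simp add: g acl(4) sM(8))
    fix y assume "y \<in> ?W"
    then obtain g' where g': "y = (\<Sum>x\<in>?X. ac (g' x) x)" by blast
    show "x + y \<in> ?W" using I[of "\<lambda>x. g x + g' x"] by (simp add: g g' acl(3) sum.distrib)
  qed
  note W = subspaceD[OF vector_space_M sub]
  have acW: "ac h x \<in> ?W" if x: "x \<in> ?W" for h x
  proof -
    obtain g where g: "x = (\<Sum>x\<in>?X. ac (g x) x)" using x by blast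
    show ?thesis using I[of "\<lambda>x. h * g x"] by (simp add: g ach(7) ac_mult)
  qed
  have XW: "x \<in> ?W" if x: "x \<in> ?X" for x
  proof -
    have xV: "x \<in> V" using x XN N0(1) by blast
    have "(\<Sum>y\<in>?X. ac (if y = x then 1 else 0) y) = (\<Sum>y\<in>?X. if y = x then x else 0)"
      by (rule sum.cong) (auto simp: ac_one proj_id[OF xV] acl(5))
    also have "\<dots> = x" using finX x by (simp add: sum.delta)
    finally show ?thesis using I[of "\<lambda>y. if y = x then 1 else 0"] by simp
  qed
  have gen: "dual f m \<in> ?W" if "lin sH (*) f" for f
    by (rule dual_in_subspace[OF sub XW[OF imageI] that])
  have dualX: "dual f x \<in> ?W" if f: "lin sH (*) f" and x: "x \<in> ?X" for f x
  proof -
    obtain b where b: "x = dual (coord b) m" using x by blast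
    note [linear_intros] = linear_comp[OF f] linear_comp[OF coord(1)]
    have "lin sH (*) (\<lambda>h. sw (*) (\<lambda>a b'. coord b b' * f a) h)" by (intro linear_intros)
    from gen[OF this] show ?thesis unfolding b dual_dual[OF f coord(1)] .
  qed
  have dualW: "dual f x \<in> ?W" if f: "lin sH (*) f" and x: "x \<in> ?W" for f x
  proof -
    have d: "lin sM sM (\<lambda>x. dual f x)" by (rule linear_dual[OF f]) (intro linear_intros)
    obtain g where g: "x = (\<Sum>x\<in>?X. ac (g x) x)" using x by blast
    have "dual f x = (\<Sum>x\<in>?X. ac (g x) (dual f x))" unfolding g linD(7)[OF d] dual_ac[OF f] ..
    also have "\<dots> \<in> ?W" by (intro W(5) acW dualX f)
    finally show ?thesis .
  qed
  have "?W \<subseteq> V" by (auto intro!: V(5) ac_mem)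
  then have "stable ?W" unfolding stable_def using sub acW dualW by simp
  moreover have "m \<in> ?W" using gen[OF linear_counit] unfolding dual_counit proj_id[OF mV] .
  ultimately show ?thesis using finX XN by (intro exI[of _ ?X] conjI)
qed

lemma simple_finitely_generated:
  assumes N: "stable N" "N \<noteq> {0}" and simple: "\<And>K. stable K \<Longrightarrow> K \<subseteq> N \<Longrightarrow> K = {0} \<or> K = N"
  shows "fin_gen_module (restrict_to M N)"
proof -
  note N0 = stableD[OF N(1)] and Nsub = subspaceD[OF vector_space_M stableD(2)[OF N(1)]]
  obtain m where m: "m \<in> N" "m \<noteq> 0" using N(2) Nsub(1) by blast
  obtain X where X: "finite X" "X \<subseteq> N" "m \<in> {\<Sum>x\<in>X. ac (g x) x | g. True}"
    "stable {\<Sum>x\<in>X. ac (g x) x | g. True}"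
    using finitely_generated_stable[OF N(1) m(1)] by blast
  have "(\<Sum>x\<in>X. ac (g x) x) \<in> N" for g using X(2) by (intro Nsub(5) N0(3)) blast
  then have "{\<Sum>x\<in>X. ac (g x) x | g. True} \<subseteq> N" by blast
  from simple[OF X(4) this] have eq: "N = {\<Sum>x\<in>X. ac (g x) x | g. True}"
  proof (rule disjE)
    assume "{\<Sum>x\<in>X. ac (g x) x | g. True} = {0}"
    with X(3) have "m \<in> {0}" by (rule back_subst[of "\<lambda>W. m \<in> W"])
    with m(2) show ?thesis by simp
  qed (rule sym)
  have "(\<Sum>x\<in>X. ac (g x) x) = (\<Sum>x\<in>X. act M (g x) x)" for g
    using X(2) N0(1) by (intro sum.cong ac_eq) auto
  then have "N = {\<Sum>x\<in>X. act M (g x) x | g. True}" by (subst eq) simp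
  then show ?thesis
    unfolding fin_gen_module_def restrict_to_simps using X(1,2) by (intro exI[of _ X] conjI)
qed

lemma simple_object_restrict:
  assumes "stable N" "N \<noteq> {0}" and simple: "\<And>K. stable K \<Longrightarrow> K \<subseteq> N \<Longrightarrow> K = {0} \<or> K = N"
  shows "simple_object H (restrict_to M N)"
proof -
  have N: "subobject H M N" by (rule stable_subobject[OF assms(1)])
  have "K = {0} \<or> K = N" if K: "subobject H (restrict_to M N) K" for K
  proof -
    have "K \<subseteq> N" "subobject H M K" using K N by (auto simp: subobject_def)
    then show ?thesis using simple subobject_iff_stable by blast
  qed
  then show ?thesis using N assms(2) by (simp add: simple_object_def subobject_def)
qed

end

lemma (in hopf_calculus) direct_sum_of_simple_subobjects:
  fixes M :: "('k, 'h, 'm::ab_group_add) dimodule"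
  assumes "semisimple_algebra TYPE('h)" "cosemisimple_coalgebra H" and M: "long_dimodule H M"
  shows "\<exists>F. direct_sum_of_subobjects H M F \<and>
    (\<forall>N\<in>F. simple_object H (restrict_to M N) \<and> fin_gen_module (restrict_to M N))"
proof -
  have "vector_space (mscale M)" "module.subspace (mscale M) (carrier M)"
    using M by (simp_all add: long_dimodule_def left_module_def k_space_def)
  then obtain \<pi> where \<pi>: "lin (mscale M) (mscale M) \<pi>" "\<And>x. \<pi> x \<in> carrier M" "\<And>x. x \<in> carrier M \<Longrightarrow> \<pi> x = x"
    using exists_projection by blast
  interpret long_calculus H M \<pi>
    by (rule long_calculus.intro[OF hopf_calculus_axioms long_calculus_axioms.intro]) (fact M \<pi>)+
  obtain t where t: "\<And>h. h * t = sH (\<epsilon> h) t" "\<epsilon> t = 1" using exists_integral[OF assms(1)] by blast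
  obtain l where l: "cointegral l" using exists_cointegral[OF assms(2)] by blast
  interpret complemented_subgroups "{N. stable N}" V by (rule complemented_subgroups_stable[OF t l])
  obtain F where F: "\<forall>N\<in>F. simple N" "internal_direct_sum F V" using direct_sum_of_simples by blast
  have st: "stable N" "N \<noteq> {0}" "\<And>K. stable K \<Longrightarrow> K \<subseteq> N \<Longrightarrow> K = {0} \<or> K = N" if "N \<in> F" for N
    using F(1) that unfolding simple_def by simp_all
  show ?thesis
    unfolding direct_sum_of_subobjects_def
    using F(2) stable_subobject[OF st(1)] simple_object_restrict[OF st] simple_finitely_generated[OF st]
    by (intro exI[of _ F] conjI ballI)
qed

theorem corollary3p7:
  fixes H :: "('k::field, 'h::ring_1) hopf"
  assumes "hopf_algebra H"
    and "bij (antipode H)"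
    and "left_noetherian TYPE('h)"
    and "semisimple_algebra TYPE('h)"
    and "cosemisimple_coalgebra H"
  shows "(\<forall>M :: ('k, 'h, 'm::ab_group_add) dimodule. long_dimodule H M \<longrightarrow>
            (\<exists>F. direct_sum_of_subobjects H M F \<and>
                 (\<forall>N\<in>F. simple_object H (restrict_to M N) \<and> fin_gen_module (restrict_to M N))) \<and>
            semisimple_object H M) \<and>
         semisimple_category H TYPE('m)"
proof -
  interpret hopf_calculus H by (rule hopf_calculus.intro[OF assms(1)])
  have sum: "\<exists>F. direct_sum_of_subobjects H M F \<and>
      (\<forall>N\<in>F. simple_object H (restrict_to M N) \<and> fin_gen_module (restrict_to M N))"
    if "long_dimodule H M" for M :: "('k, 'h, 'm) dimodule"
    by (rule direct_sum_of_simple_subobjects[OF assms(4,5) that])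
  then have semi: "semisimple_object H M" if "long_dimodule H M" for M :: "('k, 'h, 'm) dimodule"
    using that unfolding semisimple_object_def by blast
  show ?thesis unfolding semisimple_category_def using sum semi by blast
qed

end
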